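(* For every integer $\ell$ there is an integer $n$ such that every finite set $P$ of at least $n$ points in the plane contains $\ell$ collinear points or $5$ pairwise visible points (that is, the visibility graph of $P$ contains a $5$-clique).
   Context: Let $P$ be a finite set of points in the plane. $P$ contains $\ell$ collinear points if some line contains at least $\ell$ points of $P$. Two distinct points $v,w\in P$ are visible with respect to $P$ if $P\cap\overline{vw}=\{v,w\}$, where $\overline{vw}$ denotes the closed line segment between $v$ and $w$. The visibility graph of $P$ has vertex set $P$, where two distinct points are adjacent if and only if they are visible with respect to $P$. *)

theory Defs
  imports "HOL-Analysis.Analysis" "HOL-Library.Ramsey"
begin

definition is_line :: "(real^2) set \<Rightarrow> bool" where
  "is_line L \<longleftrightarrow> affine L \<and> aff_dim L = 1"

(* The points are counted on a line, with an integer threshold, so the property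
   holds for every P when l \<le> 0. *)
definition contains_collinear :: "int \<Rightarrow> (real^2) set \<Rightarrow> bool" where
  "contains_collinear l P \<longleftrightarrow> (\<exists>L. is_line L \<and> int (card (P \<inter> L)) \<ge> l)"

definition visible :: "(real^2) set \<Rightarrow> real^2 \<Rightarrow> real^2 \<Rightarrow> bool" where
  "visible P v w \<longleftrightarrow> v \<in> P \<and> w \<in> P \<and> v \<noteq> w \<and> P \<inter> closed_segment v w = {v, w}"

(* The vertex set is P itself; only the edges need a definition. *)
definition visibility_edges :: "(real^2) set \<Rightarrow> (real^2) set set" where
  "visibility_edges P = {{v, w} | v w. visible P v w}"

lemma visible_sym: "visible P v w \<longleftrightarrow> visible P w v"
  unfolding visible_def by (auto simp: closed_segment_commute insert_commute)

lemma visibility_clique_iff_pairwise_visible: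
  "clique Q (visibility_edges P) \<longleftrightarrow> pairwise (visible P) Q"
proof -
  have "{v, w} \<in> visibility_edges P \<longleftrightarrow> visible P v w" for v w
    unfolding visibility_edges_def by (auto simp: doubleton_eq_iff visible_sym)
  then show ?thesis
    unfolding clique_def pairwise_def by blast
qed

end

theory Submission
  imports Defs
begin

text \<open>
  Assume that no five points are pairwise visible. Ramsey's theorem for the orientations of triples
  gives many points in convex position unless many are collinear, so some subset has a large first
  convex layer. Each layer is bounded in terms of the next one, because the points of a layer
  beyond a fixed edge of the next layer cannot contain a convex pentagon; so a large first layer
  forces many nested layers, and there is a deep point \<open>z\<close>. Choose the first layer larger
  than the second. Then the cone from \<open>z\<close> over some edge of the first layer has no vertex of
  the second layer in its interior, and one edge of the second layer crosses the whole cone.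
  The two edges and the points further inside would form an empty pentagon unless an endpoint of the
  new edge lies on the line through \<open>z\<close> and the corresponding old endpoint. Hence the
  construction continues down to \<open>z\<close>, and the alignment persists on one side, which yields
  one collinear point per layer.
\<close>

subsection \<open>Orientation, surrounded points and hull edges\<close>

text \<open>The hypothesis acts geometrically in one way only: every strictly convex pentagon with
  vertices in the set has a point of the set in its interior. Points on its sides do no harm,
  because the pentagon can be shrunk past them. The decisive pentagon takes two vertices from one
  layer, two from the next and one further inside; this fifth vertex is chosen so near the inner
  edge that the promised interior point would be a nearer candidate. Strictness is the obstacle and
  the source of the result: the pentagon degenerates only through an alignment on the left or on the
  right, and these alignments are the collinear points. They cannot alternate from layer to layer.
  Once an endpoint on one side leaves the cone strictly, that bounding ray is forbidden to the
  points further inside as well, and this stronger emptiness is inherited by all deeper layers.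
  Peeling layers until the size drops could use up a deep point chosen beforehand. Hence only a
  lower bound on the layer size is carried along, and depth is derived from it afterwards.\<close>

definition orient :: "real^2 \<Rightarrow> real^2 \<Rightarrow> real^2 \<Rightarrow> real" where
  "orient a b c = (b$1 - a$1) * (c$2 - a$2) - (b$2 - a$2) * (c$1 - a$1)"

text \<open>This is \<open>b - a\<close> turned counterclockwise by a right angle. It exhibits
  \<open>orient a b\<close> as an affine functional, so that facts on half-planes apply.\<close>

definition normal :: "real^2 \<Rightarrow> real^2 \<Rightarrow> real^2" where
  "normal a b = vector [a$2 - b$2, b$1 - a$1]"

text \<open>\<open>surrounded S z\<close> says that \<open>z\<close> lies in the interior of the convex hull of \<open>S\<close>.\<close>

definition surrounded :: "(real^2) set \<Rightarrow> real^2 \<Rightarrow> bool" where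
  "surrounded S z \<longleftrightarrow> (\<forall>a. a \<noteq> 0 \<longrightarrow> (\<exists>s\<in>S. a \<bullet> z < a \<bullet> s))"

definition inner_points :: "(real^2) set \<Rightarrow> (real^2) set" where
  "inner_points S = {q \<in> S. surrounded S q}"

text \<open>Points in the relative interior of a side of the hull count too, not only vertices; if
  \<open>S\<close> lies on a line, all of it is outer.\<close>

definition outer_points :: "(real^2) set \<Rightarrow> (real^2) set" where
  "outer_points S = {q \<in> S. \<not> surrounded S q}"

text \<open>The set lies on the closed left side, so edges run counterclockwise. The last condition
  cuts a side of the hull into pieces between consecutive points.\<close>

definition hull_edge :: "(real^2) set \<Rightarrow> real^2 \<Rightarrow> real^2 \<Rightarrow> bool" where
  "hull_edge S x y \<longleftrightarrow> x \<in> S \<and> y \<in> S \<and> x \<noteq> y \<and> (\<forall>s\<in>S. 0 \<le> orient x y s) \<and>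
     S \<inter> closed_segment x y = {x, y}"

lemma orient_rotate: "orient b c a = orient a b c"
  unfolding orient_def by algebra

lemma orient_rotate2: "orient c a b = orient a b c"
  unfolding orient_def by algebra

lemma orient_swap: "orient b a c = - orient a b c"
  unfolding orient_def by algebra

lemma orient_swap_right: "orient a c b = - orient a b c"
  unfolding orient_def by algebra

lemma orient_refl [simp]: "orient a a b = 0" "orient a b a = 0" "orient b a a = 0"
  unfolding orient_def by algebra+

lemma orient_normal: "orient a b c = normal a b \<bullet> c - normal a b \<bullet> a"
  unfolding orient_def normal_def by (simp add: inner_vec_def sum_2 algebra_simps)

lemma normal_eq_0 [simp]: "normal a b = 0 \<longleftrightarrow> a = b"
  unfolding normal_def by (auto simp: vec_eq_iff forall_2)

section \<open>Determinant identities and barycentric coordinates\<close>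

lemma orient_combination:
  assumes "\<alpha> + \<beta> + \<gamma> = 1"
  shows "orient a b (\<alpha> *\<^sub>R p + \<beta> *\<^sub>R q + \<gamma> *\<^sub>R r) = \<alpha> * orient a b p + \<beta> * orient a b q + \<gamma> * orient a b r"
proof -
  have "normal a b \<bullet> a = (\<alpha> + \<beta> + \<gamma>) * (normal a b \<bullet> a)"
    using assms by simp
  then show ?thesis
    unfolding orient_normal by (simp add: inner_add_right algebra_simps)
qed

text \<open>The three-term Grassmann-Pluecker relation for the vectors from \<open>z\<close>. With
  two nonnegative terms on the right it yields the sign of an orientation on the left.\<close>

lemma orient_ptolemy:
  "orient z p y * orient z x q = orient z p x * orient z y q + orient z p q * orient z x y"
  unfolding orient_def by algebra

text \<open>Cramer's rule: the coordinates are ratios of signed areas.\<close>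

lemma barycentric:
  assumes "orient p q z \<noteq> 0"
  shows "r = (orient q z r / orient p q z) *\<^sub>R p + (orient z p r / orient p q z) *\<^sub>R q +
    (orient p q r / orient p q z) *\<^sub>R z"
    and "orient q z r / orient p q z + orient z p r / orient p q z + orient p q r / orient p q z = 1"
proof -
  have "orient p q z * r$1 = orient q z r * p$1 + orient z p r * q$1 + orient p q r * z$1"
    "orient p q z * r$2 = orient q z r * p$2 + orient z p r * q$2 + orient p q r * z$2"
    unfolding orient_def by algebra+
  then have "r$1 = (orient q z r * p$1 + orient z p r * q$1 + orient p q r * z$1) / orient p q z"
    "r$2 = (orient q z r * p$2 + orient z p r * q$2 + orient p q r * z$2) / orient p q z"
    using assms by (simp_all add: field_simps)
  then show "r = (orient q z r / orient p q z) *\<^sub>R p + (orient z p r / orient p q z) *\<^sub>R q +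
    (orient p q r / orient p q z) *\<^sub>R z"
    unfolding vec_eq_iff forall_2 by (simp add: add_divide_distrib)
  have "orient q z r + orient z p r + orient p q r = orient p q z"
    unfolding orient_def by algebra
  then show "orient q z r / orient p q z + orient z p r / orient p q z + orient p q r / orient p q z = 1"
    using assms by (simp add: add_divide_distrib[symmetric])
qed

lemma in_triangle:
  assumes "orient p q z > 0" "orient p q r \<ge> 0" "orient q z r \<ge> 0" "orient z p r \<ge> 0"
  shows "r \<in> convex hull {p, q, z}"
proof -
  have "orient p q z \<noteq> 0" using assms(1) by simp
  note b = barycentric[OF this, of r]
  have "0 \<le> orient q z r / orient p q z" "0 \<le> orient z p r / orient p q z" "0 \<le> orient p q r / orient p q z"
    using assms by simp_all
  with b(2) show ?thesis
    unfolding convex_hull_3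
    by (intro CollectI exI[of _ "orient q z r / orient p q z"] exI[of _ "orient z p r / orient p q z"]
        exI[of _ "orient p q r / orient p q z"] conjI b(1))
qed

lemma orient_hull_ge:
  assumes "w \<in> convex hull V" "\<And>v. v \<in> V \<Longrightarrow> orient x y v \<ge> 0"
  shows "orient x y w \<ge> 0"
proof -
  have "convex hull V \<subseteq> {u. normal x y \<bullet> u \<ge> normal x y \<bullet> x}"
    using assms(2) by (intro hull_minimal convex_halfspace_ge) (auto simp: orient_normal)
  then show ?thesis
    using assms(1) by (auto simp: orient_normal)
qed

lemma inner_hull_less:
  assumes "w \<in> convex hull V" "\<And>v. v \<in> V \<Longrightarrow> a \<bullet> v < b"
  shows "a \<bullet> w < b"
proof -
  have "convex hull V \<subseteq> {u. a \<bullet> u < b}"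
    using assms(2) by (intro hull_minimal convex_halfspace_lt) auto
  then show ?thesis
    using assms(1) by auto
qed

lemma collinear_between:
  assumes "orient x y w = 0" "x \<noteq> y"
  obtains t where "w = (1 - t) *\<^sub>R x + t *\<^sub>R y"
proof -
  have 0: "(y$1 - x$1) * (w$2 - x$2) = (y$2 - x$2) * (w$1 - x$1)"
    using assms(1) by (simp add: orient_def)
  consider "y$1 \<noteq> x$1" | "y$2 \<noteq> x$2"
    using assms(2) by (auto simp: vec_eq_iff forall_2)
  then show ?thesis
  proof cases
    case 1
    define t where "t = (w$1 - x$1) / (y$1 - x$1)"
    have t: "t * (y$1 - x$1) = w$1 - x$1"
      using 1 by (simp add: t_def)
    have "(y$1 - x$1) * (w$2 - x$2 - t * (y$2 - x$2)) = 0"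
      using 0 t by algebra
    then have "w$2 - x$2 = t * (y$2 - x$2)"
      using 1 by simp
    then have "w = (1 - t) *\<^sub>R x + t *\<^sub>R y"
      using t by (simp add: vec_eq_iff forall_2 algebra_simps)
    then show ?thesis using that by blast
  next
    case 2
    define t where "t = (w$2 - x$2) / (y$2 - x$2)"
    have t: "t * (y$2 - x$2) = w$2 - x$2"
      using 2 by (simp add: t_def)
    have "(y$2 - x$2) * (w$1 - x$1 - t * (y$1 - x$1)) = 0"
      using 0 t by algebra
    then have "w$1 - x$1 = t * (y$1 - x$1)"
      using 2 by simp
    then have "w = (1 - t) *\<^sub>R x + t *\<^sub>R y"
      using t by (simp add: vec_eq_iff forall_2 algebra_simps)
    then show ?thesis using that by blast
  qed
qed

lemma orient_line [simp]:
  "orient a b ((1 - t) *\<^sub>R x + t *\<^sub>R y) = (1 - t) * orient a b x + t * orient a b y"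
  using orient_combination[of "1 - t" t 0 a b x y x] by simp

section \<open>Supporting directions and edges of the hull\<close>

lemma inner_points_subset: "inner_points S \<subseteq> S"
  by (auto simp: inner_points_def)

lemma outer_points_subset: "outer_points S \<subseteq> S"
  by (auto simp: outer_points_def)

lemma inner_Un_outer: "inner_points S \<union> outer_points S = S"
  by (auto simp: inner_points_def outer_points_def)

lemma inner_Int_outer: "inner_points S \<inter> outer_points S = {}"
  by (auto simp: inner_points_def outer_points_def)

lemma surrounded_orient_less:
  assumes "surrounded S z" "x \<noteq> y"
  obtains s where "s \<in> S" "orient x y s < orient x y z"
proof -
  have "- normal x y \<noteq> 0" using assms(2) by simp
  with assms(1) obtain s where "s \<in> S" "- normal x y \<bullet> z < - normal x y \<bullet> s"
    unfolding surrounded_def by blast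
  then show ?thesis using that by (simp add: orient_normal)
qed

lemma surrounded_orient_greater:
  assumes "surrounded S z" "x \<noteq> y"
  obtains s where "s \<in> S" "orient x y s > orient x y z"
proof -
  obtain s where "s \<in> S" "orient y x s < orient y x z"
    using surrounded_orient_less[of S z y x] assms by blast
  then show ?thesis using that[of s] by (simp add: orient_swap[of y x])
qed

lemma hull_edge_inner_pos:
  assumes "hull_edge S x y" "surrounded S z"
  shows "orient x y z > 0"
proof -
  obtain s where "s \<in> S" "orient x y s < orient x y z"
    using surrounded_orient_less[of S z x y] assms by (auto simp: hull_edge_def)
  then show ?thesis using assms(1) by (force simp: hull_edge_def)
qed

text \<open>A direction refuting \<open>surrounded\<close> supports \<open>S\<close> at
  \<open>q\<close>. A surrounded point has some point of \<open>S\<close> strictly above it, so it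
  lies strictly below \<open>q\<close>; this strictness separates a layer from everything inside
  it.\<close>

lemma outer_pointE:
  assumes "q \<in> outer_points S"
  obtains a where "a \<noteq> 0" "\<And>s. s \<in> S \<Longrightarrow> a \<bullet> s \<le> a \<bullet> q"
    "\<And>s. surrounded S s \<Longrightarrow> a \<bullet> s < a \<bullet> q"
proof -
  obtain a where a: "a \<noteq> 0" "\<And>s. s \<in> S \<Longrightarrow> a \<bullet> s \<le> a \<bullet> q"
    using assms by (auto simp: outer_points_def surrounded_def not_less)
  have "a \<bullet> s < a \<bullet> q" if "surrounded S s" for s
    using that a unfolding surrounded_def by (meson less_le_trans)
  with a that show ?thesis by blast
qed

lemma hull_edge_outer:
  assumes "hull_edge S x y"
  shows "x \<in> outer_points S" "y \<in> outer_points S"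
  using hull_edge_inner_pos[OF assms, of x] hull_edge_inner_pos[OF assms, of y] assms
  by (auto simp: outer_points_def hull_edge_def)

text \<open>Among the pairs of points on the two sides of the ray from \<open>z\<close> through \<open>d\<close>, the pair
  whose segment crosses the ray furthest from \<open>z\<close> supports the hull.\<close>

lemma supporting_pair_generic:
  assumes fin: "finite S" and z: "surrounded S z" and dz: "d \<noteq> z"
    and gen: "\<And>s. s \<in> S \<Longrightarrow> s \<noteq> z \<Longrightarrow> orient z s d \<noteq> 0"
  obtains p q where "p \<in> S" "q \<in> S" "orient z p d > 0" "orient z d q > 0" "orient z p q > 0"
    "\<forall>s\<in>S. 0 \<le> orient p q s"
proof -
  define A where "A = {s \<in> S. orient z s d > 0}"
  define B where "B = {s \<in> S. orient z d s > 0}"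
  \<comment> \<open>By Cramer's rule the segment \<open>p q\<close> meets the line through
    \<open>z\<close> and \<open>d\<close> at \<open>z + t (d - z)\<close>.\<close>
  define t where "t = (\<lambda>(p,q). orient z p q / (orient z p d + orient z d q))"
  have "finite (A \<times> B)" using fin by (auto simp: A_def B_def)
  moreover have "A \<noteq> {}"
    using surrounded_orient_less[OF z, of z d] dz
    by (force simp: A_def orient_swap_right[of z _ d])
  moreover have "B \<noteq> {}"
    using surrounded_orient_greater[OF z, of z d] dz
    by (force simp: B_def)
  ultimately have "Max (t ` (A \<times> B)) \<in> t ` (A \<times> B)"
    by (intro Max_in) auto
  then obtain pq where "pq \<in> A \<times> B" "t pq = Max (t ` (A \<times> B))"
    by auto
  with \<open>finite (A \<times> B)\<close> have pq: "pq \<in> A \<times> B" "\<And>r. r \<in> A \<times> B \<Longrightarrow> t r \<le> t pq"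
    by auto
  obtain p q where [simp]: "pq = (p, q)" by force
  have pA: "p \<in> S" "orient z p d > 0" and qB: "q \<in> S" "orient z d q > 0"
    using pq(1) by (auto simp: A_def B_def)
  \<comment> \<open>A point beyond the line \<open>p q\<close> may replace \<open>p\<close> or
    \<open>q\<close>, according to its side of the ray; the change of \<open>t\<close> has the sign
    of \<open>- orient p q s\<close>. The point \<open>z\<close> lies on the ray and is handled at
    the end.\<close>
  have ge: "0 \<le> orient p q s" if s: "s \<in> S" "s \<noteq> z" for s
  proof (rule ccontr)
    assume "\<not> 0 \<le> orient p q s"
    then have neg: "orient p q s < 0" by simp
    consider "orient z s d > 0" | "orient z d s > 0"
      using gen[OF s] orient_swap_right[of z s d] by linarith
    then show False
    proof cases
      case 1
      then have "t (s, q) \<le> t (p, q)" using pq(2)[of "(s,q)"] s qB by (auto simp: A_def B_def)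
      then have "orient z s q * (orient z p d + orient z d q) \<le> orient z p q * (orient z s d + orient z d q)"
        using 1 pA qB by (simp add: t_def divide_simps split: if_splits)
      moreover have "orient z s q * (orient z p d + orient z d q) - orient z p q * (orient z s d + orient z d q)
         = - orient p q s * orient z d q"
        unfolding orient_def by algebra
      moreover have "- orient p q s * orient z d q > 0"
        using neg qB by (simp add: mult_neg_pos)
      ultimately show False by linarith
    next
      case 2
      then have "t (p, s) \<le> t (p, q)" using pq(2)[of "(p,s)"] s pA by (auto simp: A_def B_def)
      then have "orient z p s * (orient z p d + orient z d q) \<le> orient z p q * (orient z p d + orient z d s)"
        using 2 pA qB by (simp add: t_def divide_simps split: if_splits)
      moreover have "orient z p s * (orient z p d + orient z d q) - orient z p q * (orient z p d + orient z d s)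
         = - orient p q s * orient z p d"
        unfolding orient_def by algebra
      moreover have "- orient p q s * orient z p d > 0"
        using neg pA by (simp add: mult_neg_pos)
      ultimately show False by linarith
    qed
  qed
  have "p \<noteq> q"
    using pA qB orient_swap_right[of z p d] by auto
  then obtain s where "s \<in> S" "orient p q s < orient p q z"
    using surrounded_orient_less[OF z] by blast
  then have "orient p q z > 0" using ge by fastforce
  then have "orient z p q > 0" by (simp add: orient_rotate)
  moreover have "\<forall>s\<in>S. 0 \<le> orient p q s"
    using ge \<open>orient p q z > 0\<close> by fastforce
  ultimately show ?thesis using that pA qB by blast
qed

lemma finite_has_min:
  fixes f :: "'a \<Rightarrow> real"
  assumes "finite M" "M \<noteq> {}"
  obtains m where "m \<in> M" "\<And>r. r \<in> M \<Longrightarrow> f m \<le> f r"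
  using ex_is_arg_min_if_finite[OF assms, of f] by (auto simp: is_arg_min_linorder)

text \<open>A small counterclockwise turn of the ray moves it off the points of \<open>S\<close> without changing which
  points lie strictly on either side.\<close>

lemma supporting_pair:
  assumes fin: "finite S" and z: "surrounded S z" and dz: "d \<noteq> z"
  obtains p q where "p \<in> S" "q \<in> S" "orient z p d \<ge> 0" "orient z d q > 0" "orient z p q > 0"
    "\<forall>s\<in>S. 0 \<le> orient p q s"
proof -
  \<comment> \<open>The inner product of \<open>s - z\<close> and \<open>d - z\<close>, which is the
    rate of change of \<open>orient z s d\<close> when \<open>d\<close> moves along
    \<open>normal z d\<close>.\<close>
  define k where "k s = (s$1 - z$1) * (d$1 - z$1) + (s$2 - z$2) * (d$2 - z$2)" for s :: "real^2"
  have turn: "orient z s (d + e *\<^sub>R normal z d) = orient z s d + e * k s" for e s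
    unfolding orient_def normal_def k_def by (simp add: algebra_simps)
  have ev: "eventually (\<lambda>e. (orient z s d > 0 \<longrightarrow> orient z s d + e * k s > 0) \<and>
      (orient z s d < 0 \<longrightarrow> orient z s d + e * k s < 0)) (at_right 0)" for s
  proof -
    have lim: "((\<lambda>e. orient z s d + e * k s) \<longlongrightarrow> orient z s d + 0 * k s) (at_right 0)"
      by (intro tendsto_intros)
    consider "orient z s d > 0" | "orient z s d < 0" | "orient z s d = 0" by linarith
    then show ?thesis
    proof cases
      case 1
      then show ?thesis using order_tendstoD(1)[OF lim, of 0] by simp
    next
      case 2
      then show ?thesis using order_tendstoD(2)[OF lim, of 0] by simp
    next
      case 3
      then show ?thesis by simp
    qed
  qed
  have "eventually (\<lambda>e. e > 0 \<and> (\<forall>s\<in>S. (orient z s d > 0 \<longrightarrow> orient z s d + e * k s > 0) \<and>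
      (orient z s d < 0 \<longrightarrow> orient z s d + e * k s < 0))) (at_right 0)"
    by (intro eventually_conj eventually_at_right_less eventually_ball_finite fin ballI ev)
  then obtain e where e: "e > 0"
    and sgn: "\<And>s. s \<in> S \<Longrightarrow> orient z s d > 0 \<Longrightarrow> orient z s d + e * k s > 0"
      "\<And>s. s \<in> S \<Longrightarrow> orient z s d < 0 \<Longrightarrow> orient z s d + e * k s < 0"
    using eventually_happens'[OF trivial_limit_at_right_real] by blast
  define D where "D = (d$1 - z$1)\<^sup>2 + (d$2 - z$2)\<^sup>2"
  have D: "D > 0"
    using dz by (auto simp: D_def sum_power2_gt_zero_iff vec_eq_iff forall_2)
  \<comment> \<open>Both identities express vectors from \<open>z\<close> in the orthogonal frame
    given by \<open>d - z\<close> and \<open>normal z d\<close>.\<close>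
  have lagrange: "orient z p q * D = k q * orient z p d - k p * orient z q d" for p q
    unfolding orient_def D_def k_def by algebra
  have lagrange2: "(orient z s d)\<^sup>2 + (k s)\<^sup>2 = ((s$1 - z$1)\<^sup>2 + (s$2 - z$2)\<^sup>2) * D" for s
    unfolding orient_def D_def k_def by algebra
  define d' where "d' = d + e *\<^sub>R normal z d"
  have turn': "orient z s d' = orient z s d + e * k s" for s
    unfolding d'_def by (rule turn)
  have "d' \<noteq> z"
  proof
    assume "d' = z"
    then have "orient z d d' = 0" by simp
    moreover have "k d = D" by (simp add: k_def D_def power2_eq_square)
    ultimately show False using e D turn'[of d] by simp
  qed
  moreover have "orient z s d' \<noteq> 0" if s: "s \<in> S" "s \<noteq> z" for s
  proof
    assume *: "orient z s d' = 0"
    have "orient z s d = 0"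
      using sgn[OF s(1)] * turn'[of s] by linarith
    with * e have "k s = 0" using turn'[of s] by simp
    with \<open>orient z s d = 0\<close> lagrange2[of s] D have "(s$1 - z$1)\<^sup>2 + (s$2 - z$2)\<^sup>2 = 0" by simp
    with s(2) show False by (simp add: sum_power2_eq_zero_iff vec_eq_iff forall_2)
  qed
  ultimately obtain p q where pq: "p \<in> S" "q \<in> S" "orient z p d' > 0" "orient z d' q > 0"
    "orient z p q > 0" "\<forall>s\<in>S. 0 \<le> orient p q s"
    using supporting_pair_generic[OF fin z] by metis
  have p: "orient z p d \<ge> 0"
    using sgn(2)[OF pq(1)] pq(3) turn'[of p] by linarith
  have qneg: "orient z q d + e * k q < 0"
    using pq(4) turn'[of q] orient_swap_right[of z d' q] by linarith
  \<comment> \<open>The turn controls only strict signs, so \<open>q\<close> might still be on the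
    line \<open>z d\<close>. It would then lie behind \<open>z\<close>, and \<open>z p q\<close>
    could not be positively oriented.\<close>
  have "orient z q d < 0"
  proof (rule ccontr)
    assume "\<not> orient z q d < 0"
    then have 0: "orient z q d = 0" using sgn(1)[OF pq(2)] qneg by linarith
    with qneg e have "k q < 0" by (simp add: mult_less_0_iff)
    then have "orient z p q * D \<le> 0"
      using lagrange[of p q] 0 p by (simp add: mult_le_0_iff)
    with pq(5) D show False by (simp add: mult_le_0_iff)
  qed
  then have "orient z d q > 0" using orient_swap_right[of z d q] by linarith
  with that pq p show ?thesis by blast
qed

text \<open>A supporting pair may have points of \<open>S\<close> between its ends, but a closest
  one does not: such a point could replace \<open>p\<close> or \<open>q\<close>. The weak condition
  at \<open>p\<close> and the strict one at \<open>q\<close> are complementary, so one replacement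
  is always admissible.\<close>

lemma hull_edge_through_ray:
  assumes fin: "finite S" and z: "surrounded S z" and dz: "d \<noteq> z"
  obtains p q where "hull_edge S p q" "orient z p d \<ge> 0" "orient z d q > 0" "orient z p q > 0"
proof -
  define M where "M = {(p,q). p \<in> S \<and> q \<in> S \<and> orient z p d \<ge> 0 \<and> orient z d q > 0 \<and>
    orient z p q > 0 \<and> (\<forall>s\<in>S. 0 \<le> orient p q s)}"
  have "finite M" by (rule finite_subset[of _ "S \<times> S"]) (auto simp: M_def fin)
  moreover obtain p0 q0 where "p0 \<in> S" "q0 \<in> S" "orient z p0 d \<ge> 0" "orient z d q0 > 0"
    "orient z p0 q0 > 0" "\<forall>s\<in>S. 0 \<le> orient p0 q0 s"
    by (rule supporting_pair[OF assms])
  then have "(p0, q0) \<in> M" by (simp add: M_def)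
  then have "M \<noteq> {}" by blast
  ultimately obtain pq where pq: "pq \<in> M" "\<And>r. r \<in> M \<Longrightarrow> (\<lambda>(p,q). dist p q) pq \<le> (\<lambda>(p,q). dist p q) r"
    using finite_has_min[of M "\<lambda>(p,q). dist p q"] by blast
  obtain p q where [simp]: "pq = (p,q)" by force
  have M: "p \<in> S" "q \<in> S" "orient z p d \<ge> 0" "orient z d q > 0"
    "orient z p q > 0" "\<And>s. s \<in> S \<Longrightarrow> 0 \<le> orient p q s" using pq(1) by (auto simp: M_def)
  have "p \<noteq> q" using M by auto
  have "s = p \<or> s = q" if s: "s \<in> S" "s \<in> closed_segment p q" for s
  proof (rule ccontr)
    assume neq: "\<not> (s = p \<or> s = q)"
    obtain t where t: "s = (1 - t) *\<^sub>R p + t *\<^sub>R q" "0 \<le> t" "t \<le> 1"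
      using s(2) by (auto simp: in_segment)
    with neq have t01: "0 < t" "t < 1" by (cases "t = 0"; cases "t = 1"; simp)+
    have dpq: "0 < dist p q" using \<open>p \<noteq> q\<close> by simp
    show False
    proof (cases "orient z s d \<ge> 0")
      case True
      have "orient z s q = (1 - t) * orient z p q"
        using orient_line[of z q t p q] orient_swap_right[of z s q] orient_swap_right[of z q p]
        by (simp add: t(1))
      moreover have "orient s q u = (1 - t) * orient p q u" for u
        using orient_line[of q u t p q] orient_rotate2[of s q u] orient_rotate2[of p q u]
        by (simp add: t(1))
      ultimately have "(s, q) \<in> M"
        using True M s t01 by (simp add: M_def)
      then have "dist p q \<le> dist s q" using pq(2) by force
      moreover have "s - q = (1 - t) *\<^sub>R (p - q)" by (simp add: t(1) algebra_simps)
      then have "dist s q = (1 - t) * dist p q" using t01 by (simp add: dist_norm)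
      ultimately show False using mult_pos_pos[OF t01(1) dpq] by (simp add: algebra_simps)
    next
      case False
      then have "orient z d s > 0" using orient_swap_right[of z d s] by linarith
      moreover have "orient z p s = t * orient z p q"
        by (simp add: t(1))
      moreover have "orient p s u = t * orient p q u" for u
        using orient_line[of u p t p q] orient_rotate[of p s u] orient_rotate[of p q u]
        by (simp add: t(1))
      ultimately have "(p, s) \<in> M"
        using M s t01 by (simp add: M_def)
      then have "dist p q \<le> dist p s" using pq(2) by force
      moreover have "p - s = t *\<^sub>R (p - q)" by (simp add: t(1) algebra_simps)
      then have "dist p s = t * dist p q" using t01 by (simp add: dist_norm)
      ultimately show False using t01 dpq by simp
    qed
  qed
  then have "S \<inter> closed_segment p q = {p, q}" using M by auto
  then have "hull_edge S p q" using M \<open>p \<noteq> q\<close> by (auto simp: hull_edge_def)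
  with that M show ?thesis by blast
qed

subsection \<open>Convex pentagons\<close>

text \<open>All ten triples are listed, since five left turns alone would also admit a
  pentagram.\<close>

definition convex_pentagon :: "real^2 \<Rightarrow> real^2 \<Rightarrow> real^2 \<Rightarrow> real^2 \<Rightarrow> real^2 \<Rightarrow> bool" where
  "convex_pentagon a b c d e \<longleftrightarrow>
     orient a b c > 0 \<and> orient a b d > 0 \<and> orient a b e > 0 \<and> orient a c d > 0 \<and> orient a c e > 0 \<and>
     orient a d e > 0 \<and> orient b c d > 0 \<and> orient b c e > 0 \<and> orient b d e > 0 \<and> orient c d e > 0"

definition in_pentagon :: "real^2 \<Rightarrow> real^2 \<Rightarrow> real^2 \<Rightarrow> real^2 \<Rightarrow> real^2 \<Rightarrow> real^2 \<Rightarrow> bool" where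
  "in_pentagon a b c d e w \<longleftrightarrow>
     orient a b w > 0 \<and> orient b c w > 0 \<and> orient c d w > 0 \<and> orient d e w > 0 \<and> orient e a w > 0"

lemma convex_pentagon_rotate: "convex_pentagon a b c d e \<Longrightarrow> convex_pentagon b c d e a"
  unfolding convex_pentagon_def by (simp add: orient_rotate)

lemma surrounded_mono: "surrounded A z \<Longrightarrow> A \<subseteq> B \<Longrightarrow> surrounded B z"
  unfolding surrounded_def by blast

text \<open>Think of \<open>n\<close> and \<open>m\<close> as the neighbours of a vertex
  \<open>v\<close>, with \<open>w\<close> strictly inside the angle at \<open>v\<close>. The linear
  dependence of \<open>v - w\<close>, \<open>n - w\<close>, \<open>m - w\<close> has positive
  coefficients at the last two, so \<open>u\<close> is constant on \<open>v\<close>,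
  \<open>n\<close>, \<open>w\<close>, and these are not collinear.\<close>

lemma wedge_normal_zero:
  assumes "u \<bullet> v = u \<bullet> w" "u \<bullet> n \<le> u \<bullet> w" "u \<bullet> m \<le> u \<bullet> w" "orient v n w > 0" "orient m v w > 0"
  shows "u = 0"
proof -
  have "orient v n w * (u \<bullet> m - u \<bullet> w) + orient m v w * (u \<bullet> n - u \<bullet> w) = - orient n m w * (u \<bullet> v - u \<bullet> w)"
    unfolding orient_def inner_vec_def sum_2 by (simp add: algebra_simps)
  then have sum0: "orient v n w * (u \<bullet> m - u \<bullet> w) + orient m v w * (u \<bullet> n - u \<bullet> w) = 0"
    using assms(1) by simp
  have "orient v n w * (u \<bullet> m - u \<bullet> w) \<le> 0" "orient m v w * (u \<bullet> n - u \<bullet> w) \<le> 0"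
    using assms by (simp_all add: mult_le_0_iff)
  with sum0 have "orient m v w * (u \<bullet> n - u \<bullet> w) = 0" by linarith
  with assms(5) have n0: "u \<bullet> n = u \<bullet> w" by simp
  have "orient v n w * u$1 = (u \<bullet> v - u \<bullet> w) * (n$2 - w$2) - (u \<bullet> n - u \<bullet> w) * (v$2 - w$2)"
    "orient v n w * u$2 = (u \<bullet> n - u \<bullet> w) * (v$1 - w$1) - (u \<bullet> v - u \<bullet> w) * (n$1 - w$1)"
    unfolding orient_def inner_vec_def sum_2 by (simp_all add: algebra_simps)
  with n0 assms(1,4) show "u = 0" by (simp add: vec_eq_iff forall_2)
qed

text \<open>If no vertex were above \<open>w\<close> in direction \<open>u\<close>, some vertex
  would be level with \<open>w\<close>, because \<open>w\<close> is in the hull; the wedge at that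
  vertex then forces \<open>u = 0\<close>.\<close>

lemma in_pentagon_surrounded:
  assumes w: "w \<in> convex hull {a,b,c,d,e}" and i: "in_pentagon a b c d e w"
  shows "surrounded {a,b,c,d,e} w"
proof (rule ccontr)
  assume "\<not> surrounded {a,b,c,d,e} w"
  then obtain u where u: "u \<noteq> 0" "\<And>s. s \<in> {a,b,c,d,e} \<Longrightarrow> u \<bullet> s \<le> u \<bullet> w"
    unfolding surrounded_def by (metis not_less)
  obtain v where v: "v \<in> {a,b,c,d,e}" "u \<bullet> v \<ge> u \<bullet> w"
    using inner_hull_less[OF w, of u "u \<bullet> w"] by force
  with u(2)[OF v(1)] have eq: "u \<bullet> v = u \<bullet> w" by simp
  consider "v = a" | "v = b" | "v = c" | "v = d" | "v = e" using v(1) by blast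
  then have "u = 0"
  proof cases
    case 1 then show ?thesis using wedge_normal_zero[OF eq, of b e] u(2) i by (simp add: in_pentagon_def)
  next
    case 2 then show ?thesis using wedge_normal_zero[OF eq, of c a] u(2) i by (simp add: in_pentagon_def)
  next
    case 3 then show ?thesis using wedge_normal_zero[OF eq, of d b] u(2) i by (simp add: in_pentagon_def)
  next
    case 4 then show ?thesis using wedge_normal_zero[OF eq, of e c] u(2) i by (simp add: in_pentagon_def)
  next
    case 5 then show ?thesis using wedge_normal_zero[OF eq, of a d] u(2) i by (simp add: in_pentagon_def)
  qed
  with u(1) show False by simp
qed

text \<open>The point \<open>w\<close> lies strictly between \<open>a\<close> and \<open>b\<close>,
  so replacing \<open>a\<close> by \<open>w\<close> cuts off the triangle \<open>a w e\<close>. The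
  lost vertex \<open>a\<close> provides the decrease in the induction of
  \<open>pentagon_clique\<close>.\<close>

lemma pentagon_shrink:
  assumes P: "convex_pentagon a b c d e" and w: "w \<in> convex hull {a,b,c,d,e}"
    and nw: "w \<notin> {a,b,c,d,e}" and 0: "orient a b w = 0"
  shows "convex_pentagon w b c d e" "a \<notin> convex hull {w,b,c,d,e}"
    "in_pentagon w b c d e u \<Longrightarrow> in_pentagon a b c d e u"
proof -
  have pos: "orient a b c > 0" "orient a b d > 0" "orient a b e > 0" "orient a c d > 0" "orient a c e > 0"
     "orient a d e > 0" "orient b c d > 0" "orient b c e > 0" "orient b d e > 0" "orient c d e > 0"
    using P by (auto simp: convex_pentagon_def)
  have "a \<noteq> b" using pos(1) by auto
  then obtain t where t: "w = (1 - t) *\<^sub>R a + t *\<^sub>R b" using collinear_between[OF 0] by blast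
  have "orient b c w \<ge> 0"
    using w pos by (rule_tac orient_hull_ge[OF w]) (auto simp: orient_rotate[of b _ a])
  moreover have "orient b c w = (1 - t) * orient a b c"
    by (simp add: t orient_rotate[of b c a])
  moreover have "t \<noteq> 1" using t nw by auto
  ultimately have t1: "t < 1" using pos(1) by (simp add: zero_le_mult_iff)
  have "orient e a w \<ge> 0"
    using w pos by (rule_tac orient_hull_ge[OF w]) (auto simp: orient_rotate2[of e a])
  moreover have ew: "orient e a w = t * orient a b e"
    by (simp add: t orient_rotate2[of e a])
  moreover have "t \<noteq> 0" using t nw by auto
  ultimately have t0: "t > 0" using pos(3) by (simp add: zero_le_mult_iff)
  have wxy: "orient w x y = (1 - t) * orient a x y + t * orient b x y" for x y
  proof -
    have "orient w x y = orient x y w" by (rule orient_rotate2)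
    also have "\<dots> = (1 - t) * orient x y a + t * orient x y b" by (simp add: t)
    finally show ?thesis by (simp only: orient_rotate2[of a x y] orient_rotate2[of b x y])
  qed
  have comb: "(1 - t) * x + t * y > 0" if "x \<ge> 0" "y \<ge> 0" "x > 0 \<or> y > 0" for x y
    using that t0 t1 by (auto simp: add_pos_nonneg add_nonneg_pos)
  show new: "convex_pentagon w b c d e"
    unfolding convex_pentagon_def wxy using pos t0 t1 by (auto intro!: comb)
  show "a \<notin> convex hull {w,b,c,d,e}"
  proof
    assume "a \<in> convex hull {w,b,c,d,e}"
    then have "orient e w a \<ge> 0"
      by (rule orient_hull_ge) (use new in \<open>auto simp: convex_pentagon_def orient_rotate2[of e w]\<close>)
    moreover have "orient e w a = - orient e a w" by (rule orient_swap_right)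
    ultimately show False using ew t0 pos(3) by (simp add: mult_le_0_iff)
  qed
  show "in_pentagon a b c d e u" if u: "in_pentagon w b c d e u"
  proof -
    have u': "orient w b u > 0" "orient b c u > 0" "orient c d u > 0" "orient d e u > 0" "orient e w u > 0"
      using u by (auto simp: in_pentagon_def)
    have "orient w b u = (1 - t) * orient a b u" by (simp add: wxy)
    with u'(1) t1 have "orient a b u > 0" by (simp add: zero_less_mult_iff)
    \<comment> \<open>The value \<open>orient e w u\<close> is a convex combination of
      \<open>orient e a u\<close> and \<open>orient e b u\<close>, which settles the case of a
      negative second value. Otherwise the three-term relation with \<open>d\<close> as auxiliary
      vertex applies.\<close>
    moreover have "orient e a u > 0"
    proof (cases "orient e b u \<ge> 0")
      case True
      have "orient e a u * orient e b d = orient e a b * orient e u d + orient e a d * orient e b u"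
        by (rule orient_ptolemy)
      moreover have "orient e b d > 0" "orient e a b > 0" "orient e u d > 0" "orient e a d > 0"
        using pos u' orient_rotate2[of e b d] orient_rotate2[of e a b] orient_rotate2[of e a d]
          orient_rotate2[of u d e] orient_rotate2[of e u d] by auto
      ultimately have "orient e a u * orient e b d > 0" using True by (simp add: add_pos_nonneg)
      with \<open>orient e b d > 0\<close> show ?thesis by (simp add: zero_less_mult_iff)
    next
      case False
      have "orient e w u = (1 - t) * orient e a u + t * orient e b u"
        using wxy[of u e] by (simp only: orient_rotate2[of e w u] orient_rotate2[of e a u] orient_rotate2[of e b u]
          orient_rotate2[of w u e] orient_rotate2[of a u e] orient_rotate2[of b u e])
      moreover have "t * orient e b u < 0" using False t0 by (simp add: mult_pos_neg)
      ultimately have "(1 - t) * orient e a u > 0" using u'(5) by linarith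
      with t1 show ?thesis by (simp add: zero_less_mult_iff)
    qed
    ultimately show ?thesis using u' by (auto simp: in_pentagon_def)
  qed
qed

lemma orient_segment:
  assumes "s \<in> closed_segment x y"
  shows "orient x y s = 0"
  using assms by (auto simp: in_segment)

lemma convex_pentagon_orient_neq_0:
  assumes "convex_pentagon a b c d e" "x \<in> {a,b,c,d,e}" "y \<in> {a,b,c,d,e}" "s \<in> {a,b,c,d,e}"
    "x \<noteq> y" "s \<noteq> x" "s \<noteq> y"
  shows "orient x y s \<noteq> 0"
proof -
  define T where "T = {(a,b,c), (a,b,d), (a,b,e), (a,c,d), (a,c,e), (a,d,e), (b,c,d), (b,c,e), (b,d,e), (c,d,e)}"
  have T: "orient i j k > 0" if "(i,j,k) \<in> T" for i j k
    using that assms(1) by (auto simp: T_def convex_pentagon_def)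
  have "(x,y,s) \<in> T \<or> (y,s,x) \<in> T \<or> (s,x,y) \<in> T \<or> (y,x,s) \<in> T \<or> (x,s,y) \<in> T \<or> (s,y,x) \<in> T"
    using assms(2-) unfolding T_def by (elim insertE emptyE) simp_all
  then show ?thesis
    using T[of x y s] T[of y s x] T[of s x y] T[of y x s] T[of x s y] T[of s y x]
      orient_rotate[of y s x] orient_rotate2[of s x y] orient_swap[of y x s] orient_swap_right[of x s y]
      orient_swap[of s y x] by (smt (verit))
qed

text \<open>A further point of \<open>S\<close> in the pentagon lies on an edge, and it can replace an endpoint of
  that edge without creating interior points.\<close>

lemma pentagon_clique:
  assumes fin: "finite S" and "convex_pentagon a b c d e" "{a,b,c,d,e} \<subseteq> S"
    and "\<And>w. w \<in> S \<Longrightarrow> w \<in> convex hull {a,b,c,d,e} \<Longrightarrow> \<not> in_pentagon a b c d e w"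
  shows "\<exists>Q. Q \<subseteq> S \<and> card Q = 5 \<and> pairwise (visible S) Q"
  using assms(2-)
proof (induction "card (S \<inter> convex hull {a,b,c,d,e})" arbitrary: a b c d e rule: less_induct)
  case less
  let ?V = "{a,b,c,d,e}"
  note P = less.prems(1)
  show ?case
  proof (cases "S \<inter> convex hull ?V \<subseteq> ?V")
    case True
    have "card ?V = 5"
      using P by (auto simp: convex_pentagon_def card_insert_if)
    moreover have "visible S x y" if xy: "x \<in> ?V" "y \<in> ?V" "x \<noteq> y" for x y
    proof -
      have "closed_segment x y \<subseteq> convex hull ?V"
        by (intro closed_segment_subset hull_inc xy(1,2) convex_convex_hull)
      then have "S \<inter> closed_segment x y \<subseteq> ?V" using True by blast
      then have "S \<inter> closed_segment x y \<subseteq> {x, y}"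
        using convex_pentagon_orient_neq_0[OF P xy(1,2) _ xy(3)] orient_segment[of _ x y] by blast
      then show ?thesis using xy less.prems(2) by (auto simp: visible_def)
    qed
    ultimately show ?thesis using less.prems(2) by (intro exI[of _ ?V]) (auto simp: pairwise_def)
  next
    case False
    then obtain w where w: "w \<in> S" "w \<in> convex hull ?V" "w \<notin> ?V" by blast
    \<comment> \<open>Stated for a relabelled pentagon, so that the five rotations bring any edge
      into the position \<open>a' b'\<close>.\<close>
    have step: ?thesis if "convex_pentagon a' b' c' d' e'" "{a',b',c',d',e'} = ?V"
      "\<And>u. in_pentagon a' b' c' d' e' u \<longleftrightarrow> in_pentagon a b c d e u" "orient a' b' w = 0" for a' b' c' d' e'
    proof -
      have w': "w \<in> convex hull {a',b',c',d',e'}" "w \<notin> {a',b',c',d',e'}" using w that(2) by auto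
      have subS: "{a',b',c',d',e'} \<subseteq> S" using that(2) less.prems(2) by simp
      note sh = pentagon_shrink[OF that(1) w' that(4)]
      have sub: "convex hull {w,b',c',d',e'} \<subseteq> convex hull ?V"
        using w(2) that(2) by (intro hull_minimal) (auto intro: hull_inc)
      have "a' \<in> S \<inter> convex hull ?V" using that(2) less.prems(2) by (auto intro: hull_inc)
      then have "S \<inter> convex hull {w,b',c',d',e'} \<subset> S \<inter> convex hull ?V"
        using sub sh(2) by blast
      then have "card (S \<inter> convex hull {w,b',c',d',e'}) < card (S \<inter> convex hull ?V)"
        using fin by (intro psubset_card_mono) auto
      then show ?thesis
      proof (rule less.hyps)
        show "convex_pentagon w b' c' d' e'" by (rule sh(1))
        show "{w, b', c', d', e'} \<subseteq> S" using w(1) subS by simp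
        show "\<not> in_pentagon w b' c' d' e' u" if "u \<in> S" "u \<in> convex hull {w, b', c', d', e'}" for u
          using less.prems(3)[of u] that sub sh(3) \<open>\<And>u. in_pentagon a' b' c' d' e' u \<longleftrightarrow> in_pentagon a b c d e u\<close>
          by blast
      qed
    qed
    note P1 = convex_pentagon_rotate[OF P]
    note P2 = convex_pentagon_rotate[OF P1]
    note P3 = convex_pentagon_rotate[OF P2]
    note P4 = convex_pentagon_rotate[OF P3]
    have ge: "orient x y w \<ge> 0" if "convex_pentagon x y c' d' e'" "{x,y,c',d',e'} = ?V" for x y c' d' e'
      using w(2) unfolding that(2)[symmetric]
      by (rule orient_hull_ge) (use that(1) in \<open>auto simp: convex_pentagon_def\<close>)
    have "orient a b w \<ge> 0" "orient b c w \<ge> 0" "orient c d w \<ge> 0" "orient d e w \<ge> 0" "orient e a w \<ge> 0"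
      by (rule ge[OF P] ge[OF P1] ge[OF P2] ge[OF P3] ge[OF P4]; blast)+
    then consider "orient a b w = 0" | "orient b c w = 0" | "orient c d w = 0" | "orient d e w = 0" | "orient e a w = 0"
      using less.prems(3)[OF w(1,2)] unfolding in_pentagon_def by linarith
    then show ?thesis
    proof cases
      case 1 then show ?thesis by (intro step[OF P]) auto
    next
      case 2 then show ?thesis by (intro step[OF P1]) (auto simp: in_pentagon_def)
    next
      case 3 then show ?thesis by (intro step[OF P2]) (auto simp: in_pentagon_def)
    next
      case 4 then show ?thesis by (intro step[OF P3]) (auto simp: in_pentagon_def)
    next
      case 5 then show ?thesis by (intro step[OF P4]) (auto simp: in_pentagon_def)
    qed
  qed
qed

subsection \<open>Edges of consecutive convex layers\<close>

definition no_visible5 :: "(real^2) set \<Rightarrow> bool" where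
  "no_visible5 S \<longleftrightarrow> \<not> (\<exists>Q. Q \<subseteq> S \<and> card Q = 5 \<and> pairwise (visible S) Q)"

text \<open>Peeling removes no blocking point: an outer point is strictly extreme over the
  surrounded ones, so it is on no segment between two of them.\<close>

lemma visible_inner_points:
  assumes "visible (inner_points S) v w"
  shows "visible S v w"
proof -
  have vw: "v \<in> inner_points S" "w \<in> inner_points S" "v \<noteq> w"
    "inner_points S \<inter> closed_segment v w = {v, w}"
    using assms by (auto simp: visible_def)
  have "s \<in> inner_points S" if s: "s \<in> S" "s \<in> closed_segment v w" for s
  proof (rule ccontr)
    assume "s \<notin> inner_points S"
    then have "s \<in> outer_points S" using s inner_Un_outer by blast
    then obtain a where "\<And>u. surrounded S u \<Longrightarrow> a \<bullet> u < a \<bullet> s" by (rule outer_pointE) blast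
    then have "a \<bullet> s < a \<bullet> s"
      using s(2) vw(1,2) unfolding segment_convex_hull
      by (intro inner_hull_less[of s "{v,w}"]) (auto simp: inner_points_def)
    then show False by simp
  qed
  then have "S \<inter> closed_segment v w = {v, w}"
    using vw(4) inner_points_subset by blast
  then show ?thesis using vw inner_points_subset by (auto simp: visible_def)
qed

lemma no_visible5_inner_points:
  assumes "no_visible5 S"
  shows "no_visible5 (inner_points S)"
proof -
  have "pairwise (visible S) Q" if "pairwise (visible (inner_points S)) Q" for Q
    using that visible_inner_points by (metis pairwise_mono subset_refl)
  moreover have "Q \<subseteq> S" if "Q \<subseteq> inner_points S" for Q
    using that inner_points_subset by blast
  ultimately show ?thesis using assms unfolding no_visible5_def by meson
qed

text \<open>The vertices surround the interior point supplied by \<open>pentagon_clique\<close>, so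
  every convex pentagon reaches into the inner points. The geometric arguments use
  \<open>no_visible5\<close> in this form.\<close>

lemma no_visible5_pentagonD:
  assumes "no_visible5 S" "finite S" "convex_pentagon a b c d e" "{a,b,c,d,e} \<subseteq> S"
  obtains w where "w \<in> inner_points S" "w \<in> convex hull {a,b,c,d,e}" "in_pentagon a b c d e w"
proof -
  obtain w where w: "w \<in> S" "w \<in> convex hull {a,b,c,d,e}" "in_pentagon a b c d e w"
    using pentagon_clique[OF assms(2-4)] assms(1) unfolding no_visible5_def by blast
  then have "surrounded S w"
    using surrounded_mono[OF in_pentagon_surrounded assms(4)] by blast
  with w that show ?thesis by (auto simp: inner_points_def)
qed

text \<open>Otherwise \<open>x\<close> would be in the triangle \<open>p q z\<close> of surrounded
  points, below itself in its own supporting direction.\<close>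

lemma outer_beyond:
  assumes "x \<in> outer_points S" "surrounded S p" "surrounded S q" "surrounded S z"
    and "orient z p q > 0" "orient z p x \<ge> 0" "orient z x q \<ge> 0"
  shows "orient p q x < 0"
proof (rule ccontr)
  assume "\<not> orient p q x < 0"
  then have x: "x \<in> convex hull {p, q, z}"
    using assms(5-7) orient_rotate[of p q z] orient_rotate2[of q z x] by (intro in_triangle) linarith+
  obtain a where a: "\<And>s. surrounded S s \<Longrightarrow> a \<bullet> s < a \<bullet> x"
    by (rule outer_pointE[OF assms(1)]) blast
  have "a \<bullet> x < a \<bullet> x"
    by (rule inner_hull_less[OF x]) (use a assms(2-4) in auto)
  then show False by simp
qed

lemma hull_edge_segment:
  assumes "hull_edge S p q" "w \<in> S" "orient p q z > 0" "orient p q w = 0" "orient q z w \<ge> 0" "orient z p w \<ge> 0"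
  shows "w = p \<or> w = q"
proof -
  define \<alpha> \<beta> where "\<alpha> = orient q z w / orient p q z" and "\<beta> = orient z p w / orient p q z"
  have ge: "\<alpha> \<ge> 0" "\<beta> \<ge> 0" using assms by (simp_all add: \<alpha>_def \<beta>_def)
  have pqz: "orient p q z \<noteq> 0" using assms(3) by simp
  have 1: "\<alpha> + \<beta> = 1"
    using barycentric(2)[OF pqz, of w] assms(4) by (simp add: \<alpha>_def \<beta>_def)
  then have "\<alpha> = 1 - \<beta>" by simp
  have "w = \<alpha> *\<^sub>R p + \<beta> *\<^sub>R q"
    unfolding \<alpha>_def \<beta>_def using barycentric(1)[OF pqz, of w]
    unfolding assms(4) div_0 scaleR_zero_left add_0_right .
  then have "w \<in> closed_segment p q"
    unfolding in_segment \<open>\<alpha> = 1 - \<beta>\<close> using ge 1 by (intro exI[of _ \<beta>] conjI) simp_all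
  then show ?thesis using assms(1,2) by (auto simp: hull_edge_def)
qed

text \<open>In barycentric coordinates over \<open>p\<close>, \<open>q\<close>, \<open>z\<close>,
  the supporting direction of \<open>w\<close> is strict at \<open>z\<close>, so the weight of
  \<open>z\<close> vanishes and \<open>w\<close> is on the edge.\<close>

lemma outer_in_triangle:
  assumes "hull_edge S p q" "w \<in> outer_points S" "surrounded S z" "orient q z w \<ge> 0" "orient z p w \<ge> 0"
  shows "w = p \<or> w = q"
proof -
  have S: "p \<in> S" "q \<in> S" "w \<in> S" using assms(1,2) by (auto simp: hull_edge_def outer_points_def)
  have pqz: "orient p q z > 0" by (rule hull_edge_inner_pos[OF assms(1,3)])
  have pqw: "orient p q w \<ge> 0" using assms(1) S by (auto simp: hull_edge_def)
  obtain a where a: "\<And>s. s \<in> S \<Longrightarrow> a \<bullet> s \<le> a \<bullet> w" "\<And>s. surrounded S s \<Longrightarrow> a \<bullet> s < a \<bullet> w"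
    by (rule outer_pointE[OF assms(2)]) blast
  define \<alpha> \<beta> \<gamma> where "\<alpha> = orient q z w / orient p q z" and "\<beta> = orient z p w / orient p q z"
    and "\<gamma> = orient p q w / orient p q z"
  have ge: "\<alpha> \<ge> 0" "\<beta> \<ge> 0" "\<gamma> \<ge> 0" using assms pqz pqw by (simp_all add: \<alpha>_def \<beta>_def \<gamma>_def)
  have pqz0: "orient p q z \<noteq> 0" using pqz by simp
  have 1: "\<alpha> + \<beta> + \<gamma> = 1" unfolding \<alpha>_def \<beta>_def \<gamma>_def by (rule barycentric(2)[OF pqz0])
  have w: "w = \<alpha> *\<^sub>R p + \<beta> *\<^sub>R q + \<gamma> *\<^sub>R z"
    unfolding \<alpha>_def \<beta>_def \<gamma>_def by (rule barycentric(1)[OF pqz0])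
  have "a \<bullet> w = a \<bullet> (\<alpha> *\<^sub>R p + \<beta> *\<^sub>R q + \<gamma> *\<^sub>R z)" using w by simp
  also have "\<dots> = \<alpha> * (a \<bullet> p) + \<beta> * (a \<bullet> q) + \<gamma> * (a \<bullet> z)" by (simp add: inner_add_right)
  finally have "(\<alpha> + \<beta> + \<gamma>) * (a \<bullet> w) = \<alpha> * (a \<bullet> p) + \<beta> * (a \<bullet> q) + \<gamma> * (a \<bullet> z)"
    using 1 by simp
  moreover have "\<alpha> * (a \<bullet> p) \<le> \<alpha> * (a \<bullet> w)" "\<beta> * (a \<bullet> q) \<le> \<beta> * (a \<bullet> w)"
    using a(1)[OF S(1)] a(1)[OF S(2)] ge by (simp_all add: mult_left_mono)
  ultimately have "\<gamma> * (a \<bullet> w) \<le> \<gamma> * (a \<bullet> z)" by (simp add: algebra_simps)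
  then have "\<gamma> = 0" using a(2)[OF assms(3)] ge(3) by (auto simp: mult_le_cancel_left)
  then have "orient p q w = 0" using pqz by (simp add: \<gamma>_def)
  then show ?thesis using hull_edge_segment[OF assms(1) S(3) pqz] assms(4,5) by simp
qed

text \<open>Barycentric coordinates cleared of denominators, for reading off the sign of
  \<open>orient a b r\<close> term by term.\<close>

lemma orient_barycentric:
  "orient p q z * orient a b r =
    orient z r q * orient a b p + orient z p r * orient a b q + orient p q r * orient a b z"
  unfolding orient_def by algebra

text \<open>If the cone from \<open>z\<close> over the edge \<open>x y\<close> has no outer point of the next layer inside, it is
  crossed by a single edge \<open>p q\<close> of that layer. A point \<open>r\<close> two layers down in the triangle
  \<open>z p q\<close>, taken closest to the line \<open>p q\<close>, would complete \<open>x y q r p\<close> to a forbidden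
  pentagon unless it lies on the line \<open>x p\<close> or \<open>y q\<close>. The case \<open>r = z\<close> shows that \<open>z\<close> itself lies on
  one of these lines.\<close>

lemma next_edge:
  assumes fin: "finite S" and no5: "no_visible5 S"
    and z: "z \<in> inner_points (inner_points S)"
    and xy: "hull_edge S x y"
    and empty: "\<And>s. s \<in> outer_points (inner_points S) \<Longrightarrow> \<not> (orient z x s > 0 \<and> orient z s y > 0)"
  obtains p q where "hull_edge (inner_points S) p q" "orient z p x \<ge> 0" "orient z x q > 0"
    "orient z p y > 0" "orient z y q \<ge> 0"
    "\<And>r. r \<in> inner_points (inner_points S) \<Longrightarrow> orient z p r \<ge> 0 \<Longrightarrow> orient z r q \<ge> 0 \<Longrightarrow>
      (orient z p r > 0 \<or> orient z p x > 0) \<Longrightarrow> (orient z r q > 0 \<or> orient z y q > 0) \<Longrightarrow> False"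
proof -
  define T where "T = inner_points S"
  define U where "U = inner_points T"
  have TS: "T \<subseteq> S" and UT: "U \<subseteq> T" unfolding T_def U_def by (rule inner_points_subset)+
  have finT: "finite T" and finU: "finite U" using fin TS UT by (meson finite_subset)+
  have surT: "\<And>s. s \<in> T \<Longrightarrow> surrounded S s" and surU: "\<And>s. s \<in> U \<Longrightarrow> surrounded T s"
    by (auto simp: T_def U_def inner_points_def)
  have zU: "z \<in> U" using z by (simp add: U_def T_def)
  have zT: "z \<in> T" using zU UT by blast
  have outer: "x \<in> outer_points S" "y \<in> outer_points S" by (rule hull_edge_outer[OF xy])+
  then have "x \<noteq> z" using surT[OF zT] by (auto simp: outer_points_def)
  then obtain p q where pq: "hull_edge T p q" "orient z p x \<ge> 0" "orient z x q > 0" "orient z p q > 0"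
    using hull_edge_through_ray[OF finT surU[OF zU]] by blast
  have pT: "p \<in> T" and qT: "q \<in> T" using pq(1) by (auto simp: hull_edge_def)
  \<comment> \<open>The endpoint \<open>q\<close> is past \<open>x\<close> and is not strictly
    inside the cone, so it is not before \<open>y\<close>: the edge \<open>p q\<close> spans the
    whole cone.\<close>
  have "\<not> (orient z x q > 0 \<and> orient z q y > 0)"
    using empty hull_edge_outer(2)[OF pq(1)] by (simp add: T_def)
  then have zyq: "orient z y q \<ge> 0"
    using pq(3) orient_swap_right[of z y q] by linarith
  have xypos: "orient x y s > 0" if "s \<in> T" for s
    by (rule hull_edge_inner_pos[OF xy surT[OF that]])
  have zxy: "orient z x y > 0" using xypos[OF zT] by (simp add: orient_rotate2)
  have "orient z p y * orient z x q > 0"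
    unfolding orient_ptolemy[of z p y x q] using pq zyq zxy by (simp add: add_nonneg_pos)
  then have zpy: "orient z p y > 0" using pq(3) by (simp add: zero_less_mult_iff)
  have pqx: "orient p q x < 0"
    using pq by (intro outer_beyond[OF outer(1) surT[OF pT] surT[OF qT] surT[OF zT]]) auto
  have pqy: "orient p q y < 0"
    using pq zpy zyq by (intro outer_beyond[OF outer(2) surT[OF pT] surT[OF qT] surT[OF zT]]) auto
  \<comment> \<open>The two disjunctions give strict convexity at \<open>p\<close> and
    \<open>q\<close>: \<open>orient p x r\<close> mixes \<open>orient z p r\<close> and
    \<open>orient z p x\<close> with positive weights, and similarly for
    \<open>orient y q r\<close>. The point \<open>z\<close> is good exactly when neither endpoint is
    aligned.\<close>
  define good where "good r \<longleftrightarrow> orient z p r \<ge> 0 \<and> orient z r q \<ge> 0 \<and>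
      (orient z p r > 0 \<or> orient z p x > 0) \<and> (orient z r q > 0 \<or> orient z y q > 0)" for r
  have "\<not> good r" if "r \<in> U" for r
  proof
    assume "good r"
    then have "{r \<in> U. good r} \<noteq> {}" "finite {r \<in> U. good r}" using that finU by auto
    then obtain r where r: "r \<in> {r \<in> U. good r}"
      and rmin: "\<And>s. s \<in> {r \<in> U. good r} \<Longrightarrow> orient p q r \<le> orient p q s"
      using finite_has_min[of _ "orient p q"] by blast
    then have rU: "r \<in> U" and g: "orient z p r \<ge> 0" "orient z r q \<ge> 0"
      "orient z p r > 0 \<or> orient z p x > 0" "orient z r q > 0 \<or> orient z y q > 0"
      by (auto simp: good_def)
    have rT: "r \<in> T" using rU UT by blast
    have pqr: "orient p q r > 0" by (rule hull_edge_inner_pos[OF pq(1) surU[OF rU]])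
    have pqz: "orient p q z > 0" using pq(4) by (simp add: orient_rotate)
    have pos: "orient a b r > 0"
      if "orient z r q * orient a b p + orient z p r * orient a b q + orient p q r * orient a b z > 0" for a b
    proof -
      have "orient p q z * orient a b r > 0" using that orient_barycentric[of p q z a b r] by linarith
      with pqz show ?thesis by (simp add: zero_less_mult_iff)
    qed
    have *: "orient x q p > 0" "orient p y q > 0" "orient p x q > 0" "orient y q p > 0"
      using pqx pqy orient_rotate[of x q p] orient_rotate[of q p x] orient_rotate[of y q p]
        orient_rotate[of q p y] orient_swap_right[of p x q] orient_swap_right[of p y q] by linarith+
    have **: "orient x q z = orient z x q" "orient p y z = orient z p y" "orient p x z = orient z p x"
      "orient y q z = orient z y q"
      by (rule orient_rotate)+
    have 1: "orient x q r > 0"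
      using * ** pq g pqr by (intro pos) (simp add: add_nonneg_pos)
    have 2: "orient p y r > 0"
      using * ** zpy g pqr by (intro pos) (simp add: add_nonneg_pos)
    have 3: "orient p x r > 0"
      using * ** pq(2) g pqr by (intro pos) (auto simp: add_nonneg_pos add_pos_nonneg)
    have 4: "orient y q r > 0"
      using * ** zyq g pqr by (intro pos) (auto simp: add_nonneg_pos add_pos_nonneg)
    have "convex_pentagon x y q r p"
      unfolding convex_pentagon_def
      using xypos[OF qT] xypos[OF rT] xypos[OF pT] 1 2 3 4 * pqr
        orient_rotate2[of p x r] orient_rotate2[of p y r] orient_rotate2[of p q r]
      by (intro conjI; linarith)
    moreover have "{x,y,q,r,p} \<subseteq> S" using outer outer_points_subset TS qT rT pT by blast
    ultimately obtain w where w: "w \<in> T" and i: "in_pentagon x y q r p w"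
      using no_visible5_pentagonD[OF no5 fin] unfolding T_def by metis
    have i': "orient q r w > 0" "orient r p w > 0" using i by (auto simp: in_pentagon_def)
    \<comment> \<open>As a point of \<open>T\<close>, \<open>w\<close> is not beyond the edge
      \<open>p q\<close>. It is thus in the triangle \<open>p q r\<close>, and by
      \<open>outer_in_triangle\<close> with apex \<open>r\<close> it belongs to
      \<open>U\<close>.\<close>
    have pqw0: "orient p q w \<ge> 0" using pq(1) w by (auto simp: hull_edge_def)
    have bary: "orient p q r * orient a b w =
        orient q r w * orient a b p + orient r p w * orient a b q + orient p q w * orient a b r" for a b
      using orient_barycentric[of p q r a b w] unfolding orient_rotate[of r w q] .
    have "w \<noteq> p" "w \<noteq> q" using i' by auto
    then have nseg: "orient p q w \<noteq> 0"
      using hull_edge_segment[OF pq(1) w pqr] i' by fastforce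
    then have pqw: "orient p q w > 0" using pqw0 by simp
    have "w \<notin> outer_points T"
      using outer_in_triangle[OF pq(1) _ surU[OF rU], of w] i' \<open>w \<noteq> p\<close> \<open>w \<noteq> q\<close> by fastforce
    then have "w \<in> U" using w inner_Un_outer unfolding U_def by blast
    moreover have "good w"
    proof -
      have "orient p q r * orient z p w > 0"
        unfolding bary[of z p] using i' pq(4) g pqw by (simp add: add_pos_nonneg)
      then have "orient z p w > 0" using pqr by (simp add: zero_less_mult_iff)
      moreover have "orient p q r * orient q z w > 0"
        unfolding bary[of q z] orient_rotate2[of q z p] orient_rotate2[of q z r]
        using i' pq(4) g pqw by (simp add: add_pos_nonneg)
      then have "orient q z w > 0" using pqr by (simp add: zero_less_mult_iff)
      then have "orient z w q > 0" using orient_rotate2[of q z w] by linarith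
      ultimately show ?thesis by (simp add: good_def)
    qed
    ultimately have "orient p q r \<le> orient p q w" using rmin by blast
    \<comment> \<open>The areas of the three triangles at \<open>w\<close> add up to that of
      \<open>p q r\<close>, so \<open>w\<close> is closer to the line \<open>p q\<close> than
      \<open>r\<close>.\<close>
    moreover have "orient q r w + orient r p w + orient p q w = orient p q r"
      unfolding orient_def by algebra
    ultimately show False using i' by linarith
  qed
  with pq zpy zyq that show ?thesis unfolding T_def U_def good_def by blast
qed

text \<open>The edge met by the ray from \<open>z\<close> through \<open>x\<close> has
  \<open>x\<close> as an endpoint, and strictness at \<open>q\<close> makes it the starting
  point.\<close>

lemma hull_edge_from_outer_point:
  assumes "finite S" "surrounded S z" "x \<in> outer_points S"
  obtains y where "hull_edge S x y"
proof -
  have "x \<noteq> z" using assms(2,3) by (auto simp: outer_points_def)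
  then obtain p q where pq: "hull_edge S p q" "orient z p x \<ge> 0" "orient z x q > 0"
    using hull_edge_through_ray[OF assms(1,2)] by blast
  have "x = p \<or> x = q"
    using outer_in_triangle[OF pq(1) assms(3,2)] pq(2,3) orient_rotate2[of q z x] by linarith
  then show ?thesis using pq that by auto
qed

text \<open>Let \<open>x'\<close> be the later of the two starting points. It comes before the
  common point \<open>s\<close>, hence before \<open>y\<close>, so it lies in the cone over
  \<open>x y\<close> and \<open>outer_in_triangle\<close> leaves only \<open>x\<close>.\<close>

lemma edge_cones_disjoint:
  assumes "hull_edge S x y" "hull_edge S x' y'" "surrounded S z"
    and "orient z x s > 0" "orient z s y > 0" "orient z x' s > 0" "orient z s y' > 0"
  shows "x = x'"
proof -
  have *: "x = x'" if "hull_edge S x y" "x' \<in> outer_points S" "orient z x s > 0" "orient z s y > 0"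
    "orient z x' s > 0" "orient z x x' \<ge> 0" for x y x'
  proof -
    have "orient z x y > 0"
      using hull_edge_inner_pos[OF that(1) assms(3)] by (simp add: orient_rotate2)
    then have "orient z x s * orient z x' y > 0"
      unfolding orient_ptolemy[of z x s x' y] using that by (simp add: add_nonneg_pos)
    then have "orient z x' y > 0" using that(3) by (simp add: zero_less_mult_iff)
    moreover from this have "x' = x \<or> x' = y"
      using outer_in_triangle[OF that(1,2) assms(3)] that(6) orient_rotate2[of y z x'] by linarith
    ultimately show ?thesis by auto
  qed
  have "orient z x' x = - orient z x x'" by (rule orient_swap_right)
  then show ?thesis
    using *[OF assms(1) hull_edge_outer(1)[OF assms(2)]] *[OF assms(2) hull_edge_outer(1)[OF assms(1)]] assms(4-)
    by (cases "orient z x x' \<ge> 0") auto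
qed

section \<open>Collinear points collected layer by layer\<close>

lemma funpow_inner_points_subset: "(inner_points ^^ n) S \<subseteq> S"
proof (induction n)
  case (Suc n)
  then show ?case using inner_points_subset[of "(inner_points ^^ n) S"] by simp
qed simp

lemma finite_inner_points: "finite S \<Longrightarrow> finite (inner_points S)"
  by (simp add: inner_points_def)

lemma finite_outer_points: "finite S \<Longrightarrow> finite (outer_points S)"
  by (simp add: outer_points_def)

text \<open>All points of the line \<open>z p\<close> satisfy the new equation, and \<open>x\<close>
  is one more because it is outer while the counted points are inner.\<close>

lemma line_card_Suc:
  assumes "finite S" "p \<noteq> z" "orient z p x = 0" "x \<in> outer_points S"
    and "n \<le> card {s \<in> inner_points S. orient z p s = 0}"
  shows "Suc n \<le> card {s \<in> S. orient z x s = 0}"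
proof -
  let ?A = "{s \<in> inner_points S. orient z p s = 0}"
  have "orient z x s = 0" if s: "orient z p s = 0" for s
  proof -
    obtain t where "s = (1 - t) *\<^sub>R z + t *\<^sub>R p"
      by (rule collinear_between[OF s]) (use assms(2) in auto)
    then show ?thesis using assms(3) by (simp add: orient_swap_right[of z x p])
  qed
  then have "insert x ?A \<subseteq> {s \<in> S. orient z x s = 0}"
    using assms(4) by (auto simp: inner_points_def outer_points_def)
  then have "card (insert x ?A) \<le> card {s \<in> S. orient z x s = 0}"
    using assms(1) by (intro card_mono) auto
  moreover have "x \<notin> ?A" "finite ?A"
    using assms(1,4) by (auto simp: inner_points_def outer_points_def)
  ultimately show ?thesis using assms(5) by simp
qed

lemma line_card_1:
  assumes "finite S" "x \<in> S"
  shows "Suc 0 \<le> card {s \<in> S. orient z x s = 0}"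
proof -
  have "card {x} \<le> card {s \<in> S. orient z x s = 0}"
    using assms by (intro card_mono) auto
  then show ?thesis by simp
qed

lemma funpow_inner_points_Suc: "z \<in> (inner_points ^^ Suc n) S \<Longrightarrow> z \<in> (inner_points ^^ n) (inner_points S)"
  by (simp add: funpow_swap1)

lemma hull_edge_neq_surrounded:
  assumes "hull_edge S p q" "surrounded S z"
  shows "p \<noteq> z" "q \<noteq> z"
  using hull_edge_outer[OF assms(1)] assms(2) by (auto simp: outer_points_def)

text \<open>The last hypothesis is the invariant: the cone, closed on the side of \<open>y\<close>,
  meets the inner points only in the line \<open>z x\<close>. It forces \<open>q\<close> strictly
  out of the cone, which puts \<open>p\<close> on that line and restores the invariant for
  \<open>p q\<close>.\<close>

lemma left_aligned_chain:
  assumes "finite S" "no_visible5 S" "z \<in> (inner_points ^^ n) S" "hull_edge S x y"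
    and "\<And>r. r \<in> inner_points S \<Longrightarrow> orient z x r \<ge> 0 \<Longrightarrow> orient z r y \<ge> 0 \<Longrightarrow> orient z x r = 0"
  shows "n \<le> card {s \<in> S. orient z x s = 0}"
  using assms
proof (induction n arbitrary: S x y)
  case (Suc m)
  have x: "x \<in> outer_points S" "x \<in> S" using hull_edge_outer(1)[OF Suc.prems(4)] outer_points_subset by auto
  have zm: "z \<in> (inner_points ^^ m) (inner_points S)" by (rule funpow_inner_points_Suc) fact
  show ?case
  \<comment> \<open>The lemma \<open>next_edge\<close> needs \<open>z\<close> two layers down; with
    a single layer, \<open>x\<close> itself is the point to count.\<close>
  proof (cases m)
    case 0
    then show ?thesis using line_card_1[OF Suc.prems(1) x(2)] by simp
  next
    case (Suc k)
    then have zk: "z \<in> inner_points (inner_points S)"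
      using zm funpow_inner_points_Suc funpow_inner_points_subset by blast
    have empty: "\<not> (orient z x s > 0 \<and> orient z s y > 0)" if "s \<in> outer_points (inner_points S)" for s
      using Suc.prems(5)[of s] that by (auto simp: outer_points_def)
    obtain p q where pq: "hull_edge (inner_points S) p q" "orient z p x \<ge> 0" "orient z x q > 0"
      "orient z y q \<ge> 0"
      and al: "\<And>r. r \<in> inner_points (inner_points S) \<Longrightarrow> orient z p r \<ge> 0 \<Longrightarrow> orient z r q \<ge> 0 \<Longrightarrow>
        (orient z p r > 0 \<or> orient z p x > 0) \<Longrightarrow> (orient z r q > 0 \<or> orient z y q > 0) \<Longrightarrow> False"
      using next_edge[OF Suc.prems(1,2) zk Suc.prems(4) empty] by blast
    have "q \<in> inner_points S" using pq(1) by (auto simp: hull_edge_def)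
    then have "orient z y q \<noteq> 0"
      using Suc.prems(5)[of q] pq(3) orient_swap_right[of z y q] by linarith
    then have yq: "orient z y q > 0" using pq(4) by simp
    \<comment> \<open>The emptiness statement is applied to \<open>z\<close> itself, where only the
      strict alternatives at \<open>x\<close> and \<open>y\<close> can hold.\<close>
    have "orient z p x = 0" using al[OF zk] yq pq(2) by fastforce
    moreover have "m \<le> card {s \<in> inner_points S. orient z p s = 0}"
    proof (rule Suc.IH[OF _ _ zm pq(1)])
      show "orient z p r = 0" if "r \<in> inner_points (inner_points S)" "orient z p r \<ge> 0" "orient z r q \<ge> 0" for r
        using al[OF that] that(2) yq by fastforce
    qed (use Suc.prems finite_inner_points no_visible5_inner_points in auto)
    moreover have "p \<noteq> z"
      using hull_edge_neq_surrounded[OF pq(1)] zk by (auto simp: inner_points_def)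
    ultimately show ?thesis using line_card_Suc[OF Suc.prems(1)] x(1) by blast
  qed
qed simp

text \<open>The mirror image of \<open>left_aligned_chain\<close>, written out because orientations
  and edges are directed.\<close>

lemma right_aligned_chain:
  assumes "finite S" "no_visible5 S" "z \<in> (inner_points ^^ n) S" "hull_edge S x y"
    and "\<And>r. r \<in> inner_points S \<Longrightarrow> orient z x r \<ge> 0 \<Longrightarrow> orient z r y \<ge> 0 \<Longrightarrow> orient z r y = 0"
  shows "n \<le> card {s \<in> S. orient z y s = 0}"
  using assms
proof (induction n arbitrary: S x y)
  case (Suc m)
  have y: "y \<in> outer_points S" "y \<in> S" using hull_edge_outer(2)[OF Suc.prems(4)] outer_points_subset by auto
  have zm: "z \<in> (inner_points ^^ m) (inner_points S)" by (rule funpow_inner_points_Suc) fact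
  show ?case
  proof (cases m)
    case 0
    then show ?thesis using line_card_1[OF Suc.prems(1) y(2)] by simp
  next
    case (Suc k)
    then have zk: "z \<in> inner_points (inner_points S)"
      using zm funpow_inner_points_Suc funpow_inner_points_subset by blast
    have empty: "\<not> (orient z x s > 0 \<and> orient z s y > 0)" if "s \<in> outer_points (inner_points S)" for s
      using Suc.prems(5)[of s] that by (auto simp: outer_points_def)
    obtain p q where pq: "hull_edge (inner_points S) p q" "orient z p x \<ge> 0" "orient z p y > 0"
      "orient z y q \<ge> 0"
      and al: "\<And>r. r \<in> inner_points (inner_points S) \<Longrightarrow> orient z p r \<ge> 0 \<Longrightarrow> orient z r q \<ge> 0 \<Longrightarrow>
        (orient z p r > 0 \<or> orient z p x > 0) \<Longrightarrow> (orient z r q > 0 \<or> orient z y q > 0) \<Longrightarrow> False"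
      using next_edge[OF Suc.prems(1,2) zk Suc.prems(4) empty] by blast
    have "p \<in> inner_points S" using pq(1) by (auto simp: hull_edge_def)
    then have "orient z p x \<noteq> 0"
      using Suc.prems(5)[of p] pq(3) orient_swap_right[of z x p] by linarith
    then have px: "orient z p x > 0" using pq(2) by simp
    have "orient z y q = 0" using al[OF zk] px pq(4) by fastforce
    then have "orient z q y = 0" using orient_swap_right[of z y q] by simp
    moreover have "m \<le> card {s \<in> inner_points S. orient z q s = 0}"
    proof (rule Suc.IH[OF _ _ zm pq(1)])
      show "orient z r q = 0" if "r \<in> inner_points (inner_points S)" "orient z p r \<ge> 0" "orient z r q \<ge> 0" for r
        using al[OF that] that(3) px by fastforce
    qed (use Suc.prems finite_inner_points no_visible5_inner_points in auto)
    moreover have "q \<noteq> z"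
      using hull_edge_neq_surrounded[OF pq(1)] zk by (auto simp: inner_points_def)
    ultimately show ?thesis using line_card_Suc[OF Suc.prems(1)] y(1) by blast
  qed
qed simp

text \<open>As long as both endpoints are aligned, both lines gain a point and the open cone stays
  empty. At the first layer where one endpoint is strictly outside, the other side is aligned, and
  one of the two chains above completes the count.\<close>

lemma empty_edge_chain:
  assumes "finite S" "no_visible5 S" "z \<in> (inner_points ^^ n) S" "hull_edge S x y"
    and "\<And>s. s \<in> outer_points (inner_points S) \<Longrightarrow> \<not> (orient z x s > 0 \<and> orient z s y > 0)"
  shows "n \<le> card {s \<in> S. orient z x s = 0} \<or> n \<le> card {s \<in> S. orient z y s = 0}"
  using assms
proof (induction n arbitrary: S x y)
  case (Suc m)
  have xy: "x \<in> outer_points S" "y \<in> outer_points S" "x \<in> S"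
    using hull_edge_outer[OF Suc.prems(4)] outer_points_subset by auto
  have zm: "z \<in> (inner_points ^^ m) (inner_points S)" by (rule funpow_inner_points_Suc) fact
  show ?case
  proof (cases m)
    case 0
    then show ?thesis using line_card_1[OF Suc.prems(1) xy(3)] by simp
  next
    case (Suc k)
    then have zk: "z \<in> inner_points (inner_points S)"
      using zm funpow_inner_points_Suc funpow_inner_points_subset by blast
    obtain p q where pq: "hull_edge (inner_points S) p q" "orient z p x \<ge> 0" "orient z y q \<ge> 0"
      and al: "\<And>r. r \<in> inner_points (inner_points S) \<Longrightarrow> orient z p r \<ge> 0 \<Longrightarrow> orient z r q \<ge> 0 \<Longrightarrow>
        (orient z p r > 0 \<or> orient z p x > 0) \<Longrightarrow> (orient z r q > 0 \<or> orient z y q > 0) \<Longrightarrow> False"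
      using next_edge[OF Suc.prems(1,2) zk Suc.prems(4,5)] by blast
    have neq: "p \<noteq> z" "q \<noteq> z"
      using hull_edge_neq_surrounded[OF pq(1)] zk by (auto simp: inner_points_def)
    note inner = finite_inner_points[OF Suc.prems(1)] no_visible5_inner_points[OF Suc.prems(2)] zm pq(1)
    have left: "Suc m \<le> card {s \<in> S. orient z x s = 0}"
      if "orient z p x = 0" "m \<le> card {s \<in> inner_points S. orient z p s = 0}"
      using line_card_Suc[OF Suc.prems(1) neq(1) _ xy(1)] that by blast
    have right: "Suc m \<le> card {s \<in> S. orient z y s = 0}"
      if "orient z y q = 0" "m \<le> card {s \<in> inner_points S. orient z q s = 0}"
      using line_card_Suc[OF Suc.prems(1) neq(2) _ xy(2)] that orient_swap_right[of z y q] by simp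
    have "\<not> (orient z p x > 0 \<and> orient z y q > 0)" using al[OF zk] by auto
    then consider "orient z p x = 0" "orient z y q = 0" | "orient z p x = 0" "orient z y q > 0"
      | "orient z p x > 0" "orient z y q = 0" using pq(2,3) by linarith
    then show ?thesis
    proof cases
      case 1
      have "\<not> (orient z p s > 0 \<and> orient z s q > 0)" if "s \<in> outer_points (inner_points (inner_points S))" for s
        using al[of s] that outer_points_subset by fastforce
      from Suc.IH[OF inner this] show ?thesis using left right 1 by blast
    next
      case 2
      have "orient z p r = 0" if "r \<in> inner_points (inner_points S)" "orient z p r \<ge> 0" "orient z r q \<ge> 0" for r
        using al[OF that] that(2) 2(2) by fastforce
      from left_aligned_chain[OF inner this] show ?thesis using left 2 by blast
    next
      case 3
      have "orient z r q = 0" if "r \<in> inner_points (inner_points S)" "orient z p r \<ge> 0" "orient z r q \<ge> 0" for r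
        using al[OF that] that(3) 3(1) by fastforce
      from right_aligned_chain[OF inner this] show ?thesis using right 3 by blast
    qed
  qed
qed simp

text \<open>Pigeonhole: indexing edges by starting points gives one cone per outer point, and these
  open cones are disjoint, so the smaller next layer misses one of them.\<close>

lemma collinear_of_deep_point:
  assumes fin: "finite S" and no5: "no_visible5 S" and z: "z \<in> (inner_points ^^ Suc n) S"
    and less: "card (outer_points (inner_points S)) < card (outer_points S)"
  obtains u v where "u \<noteq> v" "Suc n \<le> card {s \<in> S. orient u v s = 0}"
proof -
  have "z \<in> inner_points S"
    using funpow_inner_points_Suc[OF z] funpow_inner_points_subset by blast
  then have sur: "surrounded S z" by (simp add: inner_points_def)
  have "\<exists>y. hull_edge S x y" if "x \<in> outer_points S" for x
    using hull_edge_from_outer_point[OF fin sur that] by blast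
  then obtain nxt where nxt: "\<And>x. x \<in> outer_points S \<Longrightarrow> hull_edge S x (nxt x)" by metis
  have "\<exists>x\<in>outer_points S. \<forall>s\<in>outer_points (inner_points S). \<not> (orient z x s > 0 \<and> orient z s (nxt x) > 0)"
  proof (rule ccontr)
    assume "\<not> ?thesis"
    then obtain g where g: "\<And>x. x \<in> outer_points S \<Longrightarrow> g x \<in> outer_points (inner_points S)"
      "\<And>x. x \<in> outer_points S \<Longrightarrow> orient z x (g x) > 0" "\<And>x. x \<in> outer_points S \<Longrightarrow> orient z (g x) (nxt x) > 0"
      by metis
    have "inj_on g (outer_points S)"
    proof (rule inj_onI)
      fix x x' assume x: "x \<in> outer_points S" "x' \<in> outer_points S" "g x = g x'"
      show "x = x'"
        using edge_cones_disjoint[OF nxt[OF x(1)] nxt[OF x(2)] sur g(2)[OF x(1)] g(3)[OF x(1)]]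
          g(2,3)[OF x(2)] x(3) by simp
    qed
    then have "card (outer_points S) \<le> card (outer_points (inner_points S))"
      using g(1) fin by (intro card_inj_on_le[of g]) (auto simp: finite_inner_points finite_outer_points)
    with less show False by simp
  qed
  then obtain x where x: "x \<in> outer_points S"
    "\<And>s. s \<in> outer_points (inner_points S) \<Longrightarrow> \<not> (orient z x s > 0 \<and> orient z s (nxt x) > 0)" by blast
  have "z \<noteq> x" "z \<noteq> nxt x" using hull_edge_neq_surrounded[OF nxt[OF x(1)] sur] by auto
  then show ?thesis
    using empty_edge_chain[OF fin no5 z nxt[OF x(1)] x(2)] that[of z x] that[of z "nxt x"] by blast
qed

subsection \<open>Depth of the convex layers\<close>

text \<open>The points are enumerated arbitrarily and triples of indices coloured by orientation. A
  homogeneous nonzero colour means convex position in the order of the enumeration or its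
  reverse.\<close>

lemma exists_convex_or_collinear:
  obtains N where "\<And>X. finite X \<Longrightarrow> N \<le> card X \<Longrightarrow>
    (\<exists>u v. u \<noteq> v \<and> l \<le> card {s \<in> X. orient u v s = 0}) \<or>
    (\<exists>v::nat \<Rightarrow> real^2. v ` {..<k} \<subseteq> X \<and>
      (\<forall>h i j. h < i \<longrightarrow> i < j \<longrightarrow> j < k \<longrightarrow> orient (v h) (v i) (v j) > 0))"
proof -
  \<comment> \<open>The maximum with 2 guarantees two distinct points to span the line in the
    collinear case.\<close>
  obtain N :: nat where N: "partn_lst {..<N} [max l 2, k, k] 3"
    using ramsey_full by blast
  have "(\<exists>u v. u \<noteq> v \<and> l \<le> card {s \<in> X. orient u v s = 0}) \<or>
    (\<exists>v::nat \<Rightarrow> real^2. v ` {..<k} \<subseteq> X \<and>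
      (\<forall>h i j. h < i \<longrightarrow> i < j \<longrightarrow> j < k \<longrightarrow> orient (v h) (v i) (v j) > 0))"
    (is "?collinear \<or> ?convex")
    if X: "finite X" "N \<le> card X" for X
  proof -
    obtain Y where Y: "Y \<subseteq> X" "card Y = N" "finite Y"
      using obtain_subset_with_card_n[OF X(2)] by metis
    then obtain e where e: "bij_betw e {..<N} Y"
      using ex_bij_betw_nat_finite[OF Y(3)] by (auto simp: atLeast0LessThan)
    define c where "c h i j = (if orient (e h) (e i) (e j) = 0 then 0
      else if orient (e h) (e i) (e j) > 0 then 1 else 2 :: nat)" for h i j
    define f where "f A = (let xs = sorted_list_of_set A in c (xs ! 0) (xs ! 1) (xs ! 2))" for A
    have f: "f {h, i, j} = c h i j" if "h < i" "i < j" for h i j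
    proof -
      have "sorted_list_of_set {h, i, j} = [h, i, j]"
        using that by (simp add: sorted_list_of_set_insert_remove)
      then show ?thesis by (simp add: f_def)
    qed
    have "f \<in> nsets {..<N} 3 \<rightarrow> {..<3}"
      by (auto simp: f_def c_def Let_def)
    then obtain a H where a: "a < 3" and H: "H \<in> nsets {..<N} ([max l 2, k, k] ! a)" "f ` nsets H 3 \<subseteq> {a}"
      using partn_lstE[OF N] by (metis length_Cons list.size(3) numeral_3_eq_3)
    define m where "m = card H"
    have H': "H \<subseteq> {..<N}" "finite H" and mH: "m = [max l 2, k, k] ! a"
      using H(1) by (auto simp: nsets_def m_def)
    define g where "g i = sorted_list_of_set H ! i" for i
    have gH: "g i \<in> H" if "i < m" for i
      using that H'(2) by (metis g_def m_def length_sorted_list_of_set nth_mem set_sorted_list_of_set)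
    have gless: "g i < g j" if "i < j" "j < m" for i j
      using that H'(2) unfolding g_def m_def
      by (metis length_sorted_list_of_set sorted_wrt_nth_less strict_sorted_list_of_set)
    have col: "c (g h) (g i) (g j) = a" if "h < i" "i < j" "j < m" for h i j
    proof -
      have lt: "g h < g i" "g i < g j" using gless that by auto
      then have "{g h, g i, g j} \<in> nsets H 3"
        using gH that by (simp add: nsets_def)
      then have "f {g h, g i, g j} \<in> f ` nsets H 3" by (rule imageI)
      with H(2) have "f {g h, g i, g j} = a" by (metis singletonD subsetD)
      then show ?thesis using f[OF lt] by simp
    qed
    have eg: "e (g i) \<in> X" if "i < m" for i
      using bij_betw_apply[OF e] gH[OF that] H'(1) Y(1) by blast
    have inj: "inj_on (\<lambda>i. e (g i)) {..<m}"
    proof (rule inj_onI)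
      fix i j assume ij: "i \<in> {..<m}" "j \<in> {..<m}" "e (g i) = e (g j)"
      then have "g i = g j"
        using e gH H'(1) unfolding bij_betw_def inj_on_def by blast
      then show "i = j" using gless[of i j] gless[of j i] ij by (metis less_irrefl lessThan_iff nat_neq_iff)
    qed
    consider "a = 0" | "a = 1" | "a = 2" using a by linarith
    then show ?thesis
    proof cases
      case 1
      then have m: "m = max l 2" using mH by simp
      have "e (g 0) \<noteq> e (g 1)"
      proof
        assume "e (g 0) = e (g 1)"
        then have "0 = (1::nat)" by (rule inj_onD[OF inj]) (use m in auto)
        then show False by simp
      qed
      moreover have "l \<le> card {s \<in> X. orient (e (g 0)) (e (g 1)) s = 0}"
      proof -
        have "orient (e (g 0)) (e (g 1)) (e (g j)) = 0" if "j < m" for j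
        proof -
          consider "j = 0" | "j = 1" | "1 < j" by linarith
          then show ?thesis
            using col[of 0 1 j] that 1 by cases (auto simp: c_def split: if_splits)
        qed
        then have "(\<lambda>i. e (g i)) ` {..<m} \<subseteq> {s \<in> X. orient (e (g 0)) (e (g 1)) s = 0}"
          using eg by auto
        then have "card ((\<lambda>i. e (g i)) ` {..<m}) \<le> card {s \<in> X. orient (e (g 0)) (e (g 1)) s = 0}"
          using X(1) by (intro card_mono) auto
        then show ?thesis using card_image[OF inj] m by simp
      qed
      ultimately show ?thesis by blast
    next
      case 2
      then have m: "m = k" using mH by simp
      have pos: "orient (e (g h)) (e (g i)) (e (g j)) > 0" if "h < i" "i < j" "j < k" for h i j
      proof -
        have "c (g h) (g i) (g j) = 1" using col[OF that(1,2)] that(3) 2 m by simp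
        then show ?thesis unfolding c_def by (simp split: if_splits)
      qed
      have sub: "(\<lambda>i. e (g i)) ` {..<k} \<subseteq> X" using eg m by auto
      show ?thesis
        by (intro disjI2 exI[of _ "\<lambda>i. e (g i)"] conjI allI impI sub pos)
    next
      case 3
      then have m: "m = k" using mH by simp
      \<comment> \<open>Clockwise triples become counterclockwise when the order is
        reversed.\<close>
      have pos: "orient (e (g (k - 1 - h))) (e (g (k - 1 - i))) (e (g (k - 1 - j))) > 0"
        if "h < i" "i < j" "j < k" for h i j
      proof -
        have "c (g (k - 1 - j)) (g (k - 1 - i)) (g (k - 1 - h)) = 2"
          using that m by (subst col) (simp_all add: 3)
        then have "orient (e (g (k - 1 - j))) (e (g (k - 1 - i))) (e (g (k - 1 - h))) < 0"
          unfolding c_def by (simp split: if_splits)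
        then show ?thesis
          using orient_swap[of "e (g (k - 1 - j))" "e (g (k - 1 - i))" "e (g (k - 1 - h))"]
            orient_rotate2[of "e (g (k - 1 - h))" "e (g (k - 1 - i))" "e (g (k - 1 - j))"] by linarith
      qed
      have sub: "(\<lambda>i. e (g (k - 1 - i))) ` {..<k} \<subseteq> X" using eg m by auto
      show ?thesis
        by (intro disjI2 exI[of _ "\<lambda>i. e (g (k - 1 - i))"] conjI allI impI sub pos)
    qed
  qed
  with that show ?thesis by blast
qed

definition few_collinear :: "nat \<Rightarrow> (real^2) set \<Rightarrow> bool" where
  "few_collinear l S \<longleftrightarrow> (\<forall>u v. u \<noteq> v \<longrightarrow> card {s \<in> S. orient u v s = 0} < l)"

lemma few_collinear_subset:
  assumes "few_collinear l S" "A \<subseteq> S" "finite S"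
  shows "few_collinear l A"
  unfolding few_collinear_def
proof (intro allI impI)
  fix u v :: "real^2" assume "u \<noteq> v"
  have "card {s \<in> A. orient u v s = 0} \<le> card {s \<in> S. orient u v s = 0}"
    using assms(2,3) by (intro card_mono) auto
  also have "\<dots> < l" using assms(1) \<open>u \<noteq> v\<close> by (simp add: few_collinear_def)
  finally show "card {s \<in> A. orient u v s = 0} < l" .
qed

text \<open>Many points without large collinear subsets contain a convex pentagon. Its hull stays in
  \<open>C\<close> but must contain an inner point.\<close>

lemma outer_points_in_convex_bound:
  obtains N where "\<And>S X C. finite S \<Longrightarrow> no_visible5 S \<Longrightarrow> few_collinear l S \<Longrightarrow> X \<subseteq> outer_points S \<Longrightarrow>
    X \<subseteq> C \<Longrightarrow> convex C \<Longrightarrow> C \<inter> inner_points S = {} \<Longrightarrow> card X < N"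
proof -
  obtain N where N: "\<And>X. finite X \<Longrightarrow> N \<le> card X \<Longrightarrow>
    (\<exists>u v. u \<noteq> v \<and> l \<le> card {s \<in> X. orient u v s = 0}) \<or>
    (\<exists>v::nat \<Rightarrow> real^2. v ` {..<5} \<subseteq> X \<and>
      (\<forall>h i j. h < i \<longrightarrow> i < j \<longrightarrow> j < 5 \<longrightarrow> orient (v h) (v i) (v j) > 0))"
    using exists_convex_or_collinear[of l 5] by blast
  have "card X < N"
    if S: "finite S" "no_visible5 S" "few_collinear l S" and X: "X \<subseteq> outer_points S" "X \<subseteq> C"
      and C: "convex C" "C \<inter> inner_points S = {}" for S X C
  proof (rule ccontr)
    assume "\<not> card X < N"
    moreover have XS: "X \<subseteq> S" using X(1) outer_points_subset by blast
    then have "finite X" using S(1) finite_subset by blast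
    moreover have "\<not> (\<exists>u v. u \<noteq> v \<and> l \<le> card {s \<in> X. orient u v s = 0})"
      using few_collinear_subset[OF S(3) XS S(1)] unfolding few_collinear_def by (metis not_less)
    ultimately obtain v :: "nat \<Rightarrow> real^2" where v: "v ` {..<5} \<subseteq> X"
      "\<And>h i j. h < i \<Longrightarrow> i < j \<Longrightarrow> j < 5 \<Longrightarrow> orient (v h) (v i) (v j) > 0"
      using N[of X] by (meson not_less)
    have P: "convex_pentagon (v 0) (v 1) (v 2) (v 3) (v 4)"
      unfolding convex_pentagon_def using v(2) by simp
    have V: "{v 0, v 1, v 2, v 3, v 4} \<subseteq> X" using v(1) by auto
    obtain w where "w \<in> inner_points S" "w \<in> convex hull {v 0, v 1, v 2, v 3, v 4}"
      using no_visible5_pentagonD[OF S(2,1) P order_trans[OF V XS]] by metis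
    moreover have "convex hull {v 0, v 1, v 2, v 3, v 4} \<subseteq> C"
      using V X(2) C(1) by (intro hull_minimal) auto
    ultimately show False using C(2) by blast
  qed
  with that show ?thesis by blast
qed

lemma convex_orient_halfplanes: "convex {x. orient p q x < 0}" "convex {x. orient p q x > 0}"
proof -
  have "{x. orient p q x < 0} = {x. normal p q \<bullet> x < normal p q \<bullet> p}"
    "{x. orient p q x > 0} = {x. normal p q \<bullet> x > normal p q \<bullet> p}"
    by (auto simp: orient_normal)
  then show "convex {x. orient p q x < 0}" "convex {x. orient p q x > 0}"
    by (simp_all add: convex_halfspace_lt convex_halfspace_gt)
qed

text \<open>If no vertex exceeds the average of the three values, all values agree, which is
  impossible for a nonzero functional on a proper triangle.\<close>

lemma surrounded_centroid:
  assumes "orient u v w \<noteq> 0" "{u, v, w} \<subseteq> S"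
  shows "surrounded S ((1/3) *\<^sub>R (u + v + w))"
  unfolding surrounded_def
proof (intro allI impI)
  fix a :: "real^2" assume "a \<noteq> 0"
  let ?z = "(1/3) *\<^sub>R (u + v + w)"
  have z: "a \<bullet> ?z = (a \<bullet> u + a \<bullet> v + a \<bullet> w) / 3" by (simp add: inner_add_right)
  show "\<exists>s\<in>S. a \<bullet> ?z < a \<bullet> s"
  proof (rule ccontr)
    assume "\<not> ?thesis"
    then have "a \<bullet> u \<le> a \<bullet> ?z" "a \<bullet> v \<le> a \<bullet> ?z" "a \<bullet> w \<le> a \<bullet> ?z"
      using assms(2) by (auto simp: not_less)
    moreover from this have "a \<bullet> u \<ge> a \<bullet> ?z" "a \<bullet> v \<ge> a \<bullet> ?z" "a \<bullet> w \<ge> a \<bullet> ?z"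
      using z by argo+
    ultimately have eq: "a \<bullet> v - a \<bullet> u = 0" "a \<bullet> w - a \<bullet> u = 0" by simp_all
    have "orient u v w * a$1 = (a \<bullet> v - a \<bullet> u) * (w$2 - u$2) - (a \<bullet> w - a \<bullet> u) * (v$2 - u$2)"
      "orient u v w * a$2 = (a \<bullet> w - a \<bullet> u) * (v$1 - u$1) - (a \<bullet> v - a \<bullet> u) * (w$1 - u$1)"
      unfolding orient_def inner_vec_def sum_2 by (simp_all add: algebra_simps)
    then have "a = 0" using eq assms(1) by (simp add: vec_eq_iff forall_2)
    with \<open>a \<noteq> 0\<close> show False by simp
  qed
qed

text \<open>Every outer point is beyond some edge of the next layer, and each such open half-plane
  misses the inner points. The square crudely counts pairs of endpoints instead of edges;
  \<open>2 * N + l\<close> covers inner points on one line: two sides and the line itself.\<close>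

lemma card_outer_points_bound:
  obtains N where "\<And>S. finite S \<Longrightarrow> no_visible5 S \<Longrightarrow> few_collinear l S \<Longrightarrow>
    card (outer_points S) \<le> (card (outer_points (inner_points S)))\<^sup>2 * N + 2 * N + l"
proof -
  obtain N where N: "\<And>S X C. finite S \<Longrightarrow> no_visible5 S \<Longrightarrow> few_collinear l S \<Longrightarrow> X \<subseteq> outer_points S \<Longrightarrow>
    X \<subseteq> C \<Longrightarrow> convex C \<Longrightarrow> C \<inter> inner_points S = {} \<Longrightarrow> card X < N"
    using outer_points_in_convex_bound by blast
  have "card (outer_points S) \<le> (card (outer_points (inner_points S)))\<^sup>2 * N + 2 * N + l"
    if S: "finite S" "no_visible5 S" "few_collinear l S" for S
  proof -
    let ?T = "inner_points S"
    let ?O = "outer_points S"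
    have finT: "finite ?T" and finO: "finite ?O" using S(1) finite_inner_points finite_outer_points by auto
    have sur: "surrounded S s" if "s \<in> ?T" for s using that by (simp add: inner_points_def)
    have neg: "card {x \<in> ?O. orient p q x < 0} < N" if "\<And>s. s \<in> ?T \<Longrightarrow> orient p q s \<ge> 0" for p q
      using that by (intro N[OF S _ _ convex_orient_halfplanes(1)[of p q]]) force+
    have pos: "card {x \<in> ?O. orient p q x > 0} < N" if "\<And>s. s \<in> ?T \<Longrightarrow> orient p q s \<le> 0" for p q
      using that by (intro N[OF S _ _ convex_orient_halfplanes(2)[of p q]]) force+
    show ?thesis
    proof (cases "\<exists>u\<in>?T. \<exists>v\<in>?T. \<exists>w\<in>?T. orient u v w \<noteq> 0")
      case True
      \<comment> \<open>The centre is a centroid, which need not belong to \<open>S\<close>.\<close>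
      then obtain z where z: "surrounded ?T z"
        using surrounded_centroid[of _ _ _ ?T] by (metis empty_subsetI insert_subset)
      have zS: "surrounded S z" using surrounded_mono[OF z inner_points_subset] .
      define E where "E = {(p,q). p \<in> outer_points ?T \<and> q \<in> outer_points ?T \<and> (\<forall>s\<in>?T. orient p q s \<ge> 0)}"
      have Esub: "E \<subseteq> outer_points ?T \<times> outer_points ?T" by (auto simp: E_def)
      have finE: "finite E" using Esub finT finite_outer_points by (meson finite_SigmaI finite_subset)
      have cardE: "card E \<le> (card (outer_points ?T))\<^sup>2"
        using card_mono[OF _ Esub] finT finite_outer_points
        by (simp add: card_cartesian_product power2_eq_square)
      have "\<exists>pq\<in>E. orient (fst pq) (snd pq) x < 0" if x: "x \<in> ?O" for x
      proof -
        have "x \<noteq> z" using x zS by (auto simp: outer_points_def)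
        then obtain p q where pq: "hull_edge ?T p q" "orient z p x \<ge> 0" "orient z x q > 0" "orient z p q > 0"
          using hull_edge_through_ray[OF finT z] by blast
        have "p \<in> ?T" "q \<in> ?T" using pq(1) by (auto simp: hull_edge_def)
        then have "orient p q x < 0"
          using outer_beyond[OF x sur sur zS pq(4,2)] pq(3) by simp
        moreover have "(p, q) \<in> E"
          using hull_edge_outer[OF pq(1)] pq(1) by (auto simp: E_def hull_edge_def)
        ultimately show ?thesis by force
      qed
      then have "?O \<subseteq> (\<Union>pq\<in>E. {x \<in> ?O. orient (fst pq) (snd pq) x < 0})" by blast
      then have "card ?O \<le> card (\<Union>pq\<in>E. {x \<in> ?O. orient (fst pq) (snd pq) x < 0})"
        using finE finO by (intro card_mono) auto
      also have "\<dots> \<le> (\<Sum>pq\<in>E. card {x \<in> ?O. orient (fst pq) (snd pq) x < 0})"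
        by (rule card_UN_le[OF finE])
      also have "\<dots> \<le> (\<Sum>pq\<in>E. N)"
        using neg by (intro sum_mono less_imp_le) (auto simp: E_def)
      also have "\<dots> \<le> (card (outer_points ?T))\<^sup>2 * N"
        using cardE by simp
      finally show ?thesis by simp
    next
      case False
      obtain u v :: "real^2" where uv: "u \<noteq> v" "\<And>s. s \<in> ?T \<Longrightarrow> orient u v s = 0"
      proof (cases "\<exists>u\<in>?T. \<exists>v\<in>?T. u \<noteq> v")
        case True
        then show ?thesis using False that by blast
      next
        case single: False
        obtain u where u: "?T \<subseteq> {u}" using single by blast
        \<comment> \<open>With at most one inner point, any line through it will do; a horizontal
          one is taken.\<close>
        have "u \<noteq> u + axis 1 1" by (simp add: axis_eq_0_iff)
        moreover have "orient u (u + axis 1 1) s = 0" if "s \<in> ?T" for s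
        proof -
          have "s = u" using that u by blast
          then show ?thesis by (simp only: orient_refl)
        qed
        ultimately show ?thesis by (rule that)
      qed
      have "?O \<subseteq> {x \<in> ?O. orient u v x < 0} \<union> {x \<in> ?O. orient u v x > 0} \<union> {x \<in> ?O. orient u v x = 0}"
        by auto
      then have "card ?O \<le> card ({x \<in> ?O. orient u v x < 0} \<union> {x \<in> ?O. orient u v x > 0} \<union> {x \<in> ?O. orient u v x = 0})"
        using finO by (intro card_mono) auto
      also have "\<dots> \<le> card {x \<in> ?O. orient u v x < 0} + card {x \<in> ?O. orient u v x > 0} + card {x \<in> ?O. orient u v x = 0}"
        by (meson add_le_mono1 card_Un_le le_trans)
      finally show ?thesis
        using neg[of u v] pos[of u v] uv
          few_collinear_subset[OF S(3) outer_points_subset S(1)] unfolding few_collinear_def by force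
    qed
  qed
  with that show ?thesis by blast
qed

text \<open>Iterates the quadratic bound: an outer layer above its value at \<open>K\<close> leaves
  at least \<open>K\<close> points in the next layer.\<close>

lemma deep_points_exist:
  "\<exists>K. \<forall>S. finite S \<longrightarrow> no_visible5 S \<longrightarrow> few_collinear l S \<longrightarrow> K \<le> card (outer_points S) \<longrightarrow>
    (inner_points ^^ n) S \<noteq> {}"
proof (induction n)
  case 0
  have "S \<noteq> {}" if "1 \<le> card (outer_points S)" for S
    using that by (auto simp: outer_points_def)
  then show ?case by (intro exI[of _ 1]) auto
next
  case (Suc n)
  then obtain K where K: "\<And>S. finite S \<Longrightarrow> no_visible5 S \<Longrightarrow> few_collinear l S \<Longrightarrow> K \<le> card (outer_points S) \<Longrightarrow>
    (inner_points ^^ n) S \<noteq> {}" by blast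
  obtain N where N: "\<And>S. finite S \<Longrightarrow> no_visible5 S \<Longrightarrow> few_collinear l S \<Longrightarrow>
    card (outer_points S) \<le> (card (outer_points (inner_points S)))\<^sup>2 * N + 2 * N + l"
    using card_outer_points_bound by blast
  have "(inner_points ^^ Suc n) S \<noteq> {}"
    if S: "finite S" "no_visible5 S" "few_collinear l S" "Suc (K\<^sup>2 * N + 2 * N + l) \<le> card (outer_points S)" for S
  proof -
    have "K \<le> card (outer_points (inner_points S))"
    proof (rule ccontr)
      assume "\<not> ?thesis"
      then have "(card (outer_points (inner_points S)))\<^sup>2 * N \<le> K\<^sup>2 * N"
        by (intro mult_right_mono power_mono) auto
      with N[OF S(1-3)] S(4) show False by linarith
    qed
    then have "(inner_points ^^ n) (inner_points S) \<noteq> {}"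
      using S by (intro K finite_inner_points no_visible5_inner_points few_collinear_subset[OF S(3) inner_points_subset])
    then show ?thesis by (simp add: funpow_swap1)
  qed
  then show ?case by blast
qed

section \<open>Reduction to a large outer layer and conclusion\<close>

lemma contains_collinear_of_line:
  assumes "finite P" "u \<noteq> v" "l \<le> int (card {s \<in> P. orient u v s = 0})"
  shows "contains_collinear l P"
proof -
  have "is_line (affine hull {u, v})"
    using assms(2) by (simp add: is_line_def aff_dim_2)
  moreover have "s \<in> affine hull {u, v}" if s: "orient u v s = 0" for s
  proof -
    obtain t where "s = (1 - t) *\<^sub>R u + t *\<^sub>R v" using collinear_between[OF s assms(2)] .
    moreover have "(1 - t) + t = 1" by simp
    ultimately show ?thesis unfolding affine_hull_2 by blast
  qed
  then have "{s \<in> P. orient u v s = 0} \<subseteq> P \<inter> affine hull {u, v}" by blast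
  then have "card {s \<in> P. orient u v s = 0} \<le> card (P \<inter> affine hull {u, v})"
    using assms(1) by (intro card_mono) auto
  ultimately show ?thesis
    unfolding contains_collinear_def using assms(3) by (intro exI[of _ "affine hull {u, v}"]) auto
qed

text \<open>Segments between points of \<open>C\<close> stay in \<open>C\<close>, so the restriction
  discards no blocking point.\<close>

lemma visible_convex_subset:
  assumes "convex C" "visible (P \<inter> C) v w"
  shows "visible P v w"
proof -
  have "closed_segment v w \<subseteq> C"
    using assms by (intro closed_segment_subset) (auto simp: visible_def)
  then have "P \<inter> closed_segment v w = P \<inter> C \<inter> closed_segment v w" by blast
  then show ?thesis using assms(2) by (auto simp: visible_def)
qed

lemma no_visible5_convex_subset:
  assumes "no_visible5 P" "convex C"
  shows "no_visible5 (P \<inter> C)"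
  unfolding no_visible5_def
proof
  assume "\<exists>Q. Q \<subseteq> P \<inter> C \<and> card Q = 5 \<and> pairwise (visible (P \<inter> C)) Q"
  then obtain Q where Q: "Q \<subseteq> P \<inter> C" "card Q = 5" "pairwise (visible (P \<inter> C)) Q" by blast
  have "pairwise (visible P) Q"
    using Q(3) visible_convex_subset[OF assms(2)] unfolding pairwise_def by blast
  with Q assms(1) show False unfolding no_visible5_def by blast
qed

text \<open>The outer layer of \<open>P\<close> itself may be as small as a triangle. Cutting
  \<open>P\<close> down to the hull of a convex polygon makes all polygon vertices outer, each being
  supported by its side towards the next vertex.\<close>

lemma convex_polygon_outer:
  fixes v :: "nat \<Rightarrow> real^2"
  assumes k: "3 \<le> k" and v: "\<And>h i j. h < i \<Longrightarrow> i < j \<Longrightarrow> j < k \<Longrightarrow> orient (v h) (v i) (v j) > 0"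
    and P: "v ` {..<k} \<subseteq> P" "finite P"
  shows "k \<le> card (outer_points (P \<inter> convex hull (v ` {..<k})))"
proof -
  let ?S = "P \<inter> convex hull (v ` {..<k})"
  have neq: "v i \<noteq> v j" if "i < j" "j < k" for i j
  proof -
    consider "0 < i" | "i = 0" "j < k - 1" | "i = 0" "1 < j" using that k by linarith
    then show ?thesis
    proof cases
      case 1 then show ?thesis using v[of 0 i j] that by auto
    next
      case 2 then show ?thesis using v[of i j "k - 1"] that by auto
    next
      case 3 then show ?thesis using v[of i 1 j] that by auto
    qed
  qed
  then have inj: "inj_on v {..<k}"
    by (intro inj_onI) (metis lessThan_iff nat_neq_iff)
  have "v i \<in> outer_points ?S" if i: "i < k" for i
  proof -
    \<comment> \<open>The cyclic successor; after the last vertex it wraps around to 0.\<close>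
    define i' where "i' = (if Suc i < k then Suc i else 0)"
    have ne: "v i \<noteq> v i'" using neq[of i i'] neq[of i' i] i k by (auto simp: i'_def split: if_splits)
    have ge: "orient (v i) (v i') (v j) \<ge> 0" if j: "j < k" for j
    proof (cases "j = i \<or> j = i'")
      case True then show ?thesis by auto
    next
      case False
      show ?thesis
      proof (cases "Suc i < k")
        case True
        then have "i < j \<longrightarrow> Suc i < j" using False by (auto simp: i'_def)
        then show ?thesis
          using True False v[of i "Suc i" j] v[of j i "Suc i"] j orient_rotate[of "v i" "v (Suc i)" "v j"]
          by (cases "i < j") (auto simp: i'_def)
      next
        case last: False
        then have "0 < j" "j < i" using False j i by (auto simp: i'_def)
        then have "orient (v 0) (v j) (v i) > 0" using v i by blast
        then show ?thesis using last orient_rotate2[of "v i" "v 0" "v j"] by (simp add: i'_def)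
      qed
    qed
    have "\<not> surrounded ?S (v i)"
    proof
      assume "surrounded ?S (v i)"
      then obtain s where "s \<in> ?S" "orient (v i) (v i') s < orient (v i) (v i') (v i)"
        using surrounded_orient_less[OF _ ne] by blast
      moreover from this have "orient (v i) (v i') s \<ge> 0"
        by (intro orient_hull_ge[of s "v ` {..<k}"]) (use ge in auto)
      ultimately show False by simp
    qed
    moreover have "v i \<in> ?S" using i P(1) by (auto intro: hull_inc)
    ultimately show ?thesis by (simp add: outer_points_def)
  qed
  then have "v ` {..<k} \<subseteq> outer_points ?S" by auto
  then have "card (v ` {..<k}) \<le> card (outer_points ?S)"
    using P(2) by (intro card_mono finite_outer_points) auto
  then show ?thesis using card_image[OF inj] by simp
qed

text \<open>Peel while the next layer is at least as large: the lower bound survives each step, and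
  the process ends because the set is finite and loses points.\<close>

lemma layers_eventually_shrink:
  assumes "finite S" "no_visible5 S" "few_collinear l S" "Suc k \<le> card (outer_points S)"
  obtains T where "finite T" "no_visible5 T" "few_collinear l T" "Suc k \<le> card (outer_points T)"
    "card (outer_points (inner_points T)) < card (outer_points T)"
  using assms
proof (induction "card S" arbitrary: S thesis rule: less_induct)
  case less
  show ?case
  proof (cases "card (outer_points (inner_points S)) < card (outer_points S)")
    case True
    with less.prems show ?thesis by blast
  next
    case False
    have "outer_points S \<noteq> {}" using less.prems(5) by auto
    then have "inner_points S \<subset> S" using inner_Int_outer[of S] inner_Un_outer[of S] by blast
    then have "card (inner_points S) < card S" using less.prems(2) by (rule psubset_card_mono[rotated])
    then show ?thesis
    proof (rule less.hyps)
      show "few_collinear l (inner_points S)"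
        by (rule few_collinear_subset[OF less.prems(4) inner_points_subset less.prems(2)])
      show "Suc k \<le> card (outer_points (inner_points S))" using False less.prems(5) by simp
    qed (use less.prems finite_inner_points no_visible5_inner_points in auto)
  qed
qed

theorem theorem5:
  shows "\<forall>l::int. \<exists>n::int. \<forall>P::(real^2) set.
    finite P \<and> int (card P) \<ge> n \<longrightarrow>
      contains_collinear l P \<or>
      (\<exists>Q. Q \<subseteq> P \<and> card Q = 5 \<and> pairwise (visible P) Q)"
proof
  fix l :: int
  \<comment> \<open>The successor matches the count from \<open>collinear_of_deep_point\<close>;
    without \<open>l\<close> collinear points every line still has fewer than
    \<open>L\<close>.\<close>
  define L where "L = Suc (nat l)"
  obtain K where K: "\<And>S. finite S \<Longrightarrow> no_visible5 S \<Longrightarrow> few_collinear L S \<Longrightarrow> K \<le> card (outer_points S) \<Longrightarrow>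
    (inner_points ^^ L) S \<noteq> {}"
    using deep_points_exist by metis
  \<comment> \<open>At least 3 vertices are needed for a polygon, and \<open>K\<close> of them for
    depth.\<close>
  obtain N where N: "\<And>X. finite X \<Longrightarrow> N \<le> card X \<Longrightarrow>
    (\<exists>u v. u \<noteq> v \<and> L \<le> card {s \<in> X. orient u v s = 0}) \<or>
    (\<exists>v::nat \<Rightarrow> real^2. v ` {..<K + 3} \<subseteq> X \<and>
      (\<forall>h i j. h < i \<longrightarrow> i < j \<longrightarrow> j < K + 3 \<longrightarrow> orient (v h) (v i) (v j) > 0))"
    using exists_convex_or_collinear[of L "K + 3"] by blast
  have "\<not> no_visible5 P" if P: "finite P" "N \<le> card P" "\<not> contains_collinear l P" for P
  proof
    assume no5: "no_visible5 P"
    have few: "few_collinear L P"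
      unfolding few_collinear_def
    proof (intro allI impI)
      fix u v :: "real^2" assume "u \<noteq> v"
      then have "\<not> l \<le> int (card {s \<in> P. orient u v s = 0})"
        using contains_collinear_of_line[OF P(1)] P(3) by blast
      then show "card {s \<in> P. orient u v s = 0} < L" unfolding L_def by linarith
    qed
    then obtain v :: "nat \<Rightarrow> real^2" where v: "v ` {..<K + 3} \<subseteq> P"
      "\<And>h i j. h < i \<Longrightarrow> i < j \<Longrightarrow> j < K + 3 \<Longrightarrow> orient (v h) (v i) (v j) > 0"
      using N[OF P(1,2)] unfolding few_collinear_def by (meson not_less)
    let ?C = "convex hull (v ` {..<K + 3})"
    have card: "Suc (K + 2) \<le> card (outer_points (P \<inter> ?C))"
      using convex_polygon_outer[OF _ v(2,1) P(1)] by simp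
    have start: "finite (P \<inter> ?C)" "no_visible5 (P \<inter> ?C)" "few_collinear L (P \<inter> ?C)"
      using P(1) no5 few no_visible5_convex_subset convex_convex_hull
        few_collinear_subset[OF few _ P(1)] by auto
    obtain T where T: "finite T" "no_visible5 T" "few_collinear L T" "Suc (K + 2) \<le> card (outer_points T)"
      "card (outer_points (inner_points T)) < card (outer_points T)"
      using layers_eventually_shrink[OF start card] .
    \<comment> \<open>The deep point is chosen only now, after peeling, from the preserved size of
      the outer layer of \<open>T\<close>.\<close>
    obtain z where "z \<in> (inner_points ^^ L) T"
      using K[OF T(1-3)] T(4) by fastforce
    then have z: "z \<in> (inner_points ^^ Suc (nat l)) T" by (simp add: L_def)
    obtain u v where "u \<noteq> v" "L \<le> card {s \<in> T. orient u v s = 0}"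
      by (rule collinear_of_deep_point[OF T(1,2) z T(5)]) (simp add: L_def)
    with T(3) show False unfolding few_collinear_def by (meson not_less)
  qed
  then show "\<exists>n::int. \<forall>P::(real^2) set. finite P \<and> int (card P) \<ge> n \<longrightarrow>
      contains_collinear l P \<or> (\<exists>Q. Q \<subseteq> P \<and> card Q = 5 \<and> pairwise (visible P) Q)"
    unfolding no_visible5_def by (intro exI[of _ "int N"]) (metis of_nat_le_iff)
qed

end
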